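(* Let $\mathcal{A}$ be an abelian category with enough projectives. Then $$\mathrm{fp}_{!*}(\mathcal{A}^{\mathrm{op}},\mathrm{Ab})=\{F\in\mathrm{fp}(\mathcal{A}^{\mathrm{op}},\mathrm{Ab}):(\mathrm{fp}_0(\mathcal{A}^{\mathrm{op}},\mathrm{Ab}),F)=0\text{ and }(F,\mathrm{fp}_0(\mathcal{A}^{\mathrm{op}},\mathrm{Ab}))=0\}.$$
   Context: A functor $F:\mathcal{A}^{\mathrm{op}}\to\mathrm{Ab}$ is finitely presented if there is an exact sequence $\mathrm{Hom}_{\mathcal{A}}(-,B)\to\mathrm{Hom}_{\mathcal{A}}(-,C)\to F\to 0$ with $B,C\in\mathcal{A}$; $\mathrm{fp}(\mathcal{A}^{\mathrm{op}},\mathrm{Ab})$ is the (abelian) category of such functors. $\mathrm{fp}_0(\mathcal{A}^{\mathrm{op}},\mathrm{Ab})$ is the full subcategory of those $F$ with $FP=0$ for every projective $P\in\mathcal{A}$. For $A,B\in\mathcal{A}$, $\mathcal{P}(B,A)$ is the subgroup of $\mathrm{Hom}_{\mathcal{A}}(B,A)$ of morphisms factoring through a projective object; $\mathcal{P}(-,A)\in\mathrm{fp}(\mathcal{A}^{\mathrm{op}},\mathrm{Ab})$. The full subcategory $\mathrm{fp}_{!*}(\mathcal{A}^{\mathrm{op}},\mathrm{Ab})$ is $\{F\in\mathrm{fp}(\mathcal{A}^{\mathrm{op}},\mathrm{Ab}):\exists A\in\mathcal{A}\text{ such that }F\cong\mathcal{P}(-,A)\}$. $(F,G)$ denotes the group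 of natural transformations $F\to G$, and $(\mathcal{X},F)=0$ (resp. $(F,\mathcal{X})=0$) means $(X,F)=0$ (resp. $(F,X)=0$) for all $X\in\mathcal{X}$. *)

theory Defs
  imports "HOL-Algebra.Elementary_Groups"
begin

text \<open>
  Abelian groups are \<open>comm_group\<close>s of HOL-Algebra, hence written multiplicatively:
  \<open>f \<otimes>\<^bsub>Hom C X Y\<^esub> g\<close> is the sum of two morphisms and \<open>\<one>\<^bsub>Hom C X Y\<^esub>\<close> the zero morphism.
  The arrow \<open>g \<circ> f\<close> is \<open>Comp C g f\<close>.
\<close>

record ('o, 'm) ab_cat =
  Obj :: "'o set"
  Hom :: "'o \<Rightarrow> 'o \<Rightarrow> 'm monoid"
  Id :: "'o \<Rightarrow> 'm"
  Comp :: "'m \<Rightarrow> 'm \<Rightarrow> 'm"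

abbreviation arr :: "('o, 'm) ab_cat \<Rightarrow> 'o \<Rightarrow> 'o \<Rightarrow> 'm set" where
  "arr C X Y \<equiv> carrier (Hom C X Y)"


section \<open>Abelian categories\<close>

locale preadditive_category =
  fixes C :: "('o, 'm) ab_cat"
  assumes hom_disjoint:
      "\<lbrakk>X \<in> Obj C; Y \<in> Obj C; X' \<in> Obj C; Y' \<in> Obj C; f \<in> arr C X Y; f \<in> arr C X' Y'\<rbrakk>
        \<Longrightarrow> X = X' \<and> Y = Y'"
    and id_closed: "X \<in> Obj C \<Longrightarrow> Id C X \<in> arr C X X"
    and comp_closed:
      "\<lbrakk>X \<in> Obj C; Y \<in> Obj C; Z \<in> Obj C; f \<in> arr C X Y; g \<in> arr C Y Z\<rbrakk>
        \<Longrightarrow> Comp C g f \<in> arr C X Z"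
    and id_left: "\<lbrakk>X \<in> Obj C; Y \<in> Obj C; f \<in> arr C X Y\<rbrakk> \<Longrightarrow> Comp C (Id C Y) f = f"
    and id_right: "\<lbrakk>X \<in> Obj C; Y \<in> Obj C; f \<in> arr C X Y\<rbrakk> \<Longrightarrow> Comp C f (Id C X) = f"
    and comp_assoc:
      "\<lbrakk>W \<in> Obj C; X \<in> Obj C; Y \<in> Obj C; Z \<in> Obj C;
        f \<in> arr C W X; g \<in> arr C X Y; h \<in> arr C Y Z\<rbrakk>
        \<Longrightarrow> Comp C h (Comp C g f) = Comp C (Comp C h g) f"
    and hom_comm_group: "\<lbrakk>X \<in> Obj C; Y \<in> Obj C\<rbrakk> \<Longrightarrow> comm_group (Hom C X Y)"
    and comp_add_right:
      "\<lbrakk>X \<in> Obj C; Y \<in> Obj C; Z \<in> Obj C; f \<in> arr C X Y; f' \<in> arr C X Y; g \<in> arr C Y Z\<rbrakk>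
        \<Longrightarrow> Comp C g (f \<otimes>\<^bsub>Hom C X Y\<^esub> f') = Comp C g f \<otimes>\<^bsub>Hom C X Z\<^esub> Comp C g f'"
    and comp_add_left:
      "\<lbrakk>X \<in> Obj C; Y \<in> Obj C; Z \<in> Obj C; f \<in> arr C X Y; g \<in> arr C Y Z; g' \<in> arr C Y Z\<rbrakk>
        \<Longrightarrow> Comp C (g \<otimes>\<^bsub>Hom C Y Z\<^esub> g') f = Comp C g f \<otimes>\<^bsub>Hom C X Z\<^esub> Comp C g' f"

definition monic :: "('o, 'm) ab_cat \<Rightarrow> 'o \<Rightarrow> 'o \<Rightarrow> 'm \<Rightarrow> bool" where
  "monic C X Y f \<longleftrightarrow> f \<in> arr C X Y \<and>
     (\<forall>W\<in>Obj C. \<forall>u\<in>arr C W X. \<forall>v\<in>arr C W X. Comp C f u = Comp C f v \<longrightarrow> u = v)"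

definition epic :: "('o, 'm) ab_cat \<Rightarrow> 'o \<Rightarrow> 'o \<Rightarrow> 'm \<Rightarrow> bool" where
  "epic C X Y f \<longleftrightarrow> f \<in> arr C X Y \<and>
     (\<forall>Z\<in>Obj C. \<forall>u\<in>arr C Y Z. \<forall>v\<in>arr C Y Z. Comp C u f = Comp C v f \<longrightarrow> u = v)"

definition zero_object :: "('o, 'm) ab_cat \<Rightarrow> 'o \<Rightarrow> bool" where
  "zero_object C Z \<longleftrightarrow> Z \<in> Obj C \<and>
     (\<forall>X\<in>Obj C. (\<exists>!f. f \<in> arr C X Z) \<and> (\<exists>!f. f \<in> arr C Z X))"

definition biproduct ::
  "('o, 'm) ab_cat \<Rightarrow> 'o \<Rightarrow> 'o \<Rightarrow> 'o \<Rightarrow> 'm \<Rightarrow> 'm \<Rightarrow> 'm \<Rightarrow> 'm \<Rightarrow> bool" where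
  "biproduct C X Y S i\<^sub>1 i\<^sub>2 p\<^sub>1 p\<^sub>2 \<longleftrightarrow> S \<in> Obj C \<and>
     i\<^sub>1 \<in> arr C X S \<and> i\<^sub>2 \<in> arr C Y S \<and> p\<^sub>1 \<in> arr C S X \<and> p\<^sub>2 \<in> arr C S Y \<and>
     Comp C p\<^sub>1 i\<^sub>1 = Id C X \<and> Comp C p\<^sub>2 i\<^sub>2 = Id C Y \<and>
     Comp C i\<^sub>1 p\<^sub>1 \<otimes>\<^bsub>Hom C S S\<^esub> Comp C i\<^sub>2 p\<^sub>2 = Id C S"

definition is_kernel :: "('o, 'm) ab_cat \<Rightarrow> 'o \<Rightarrow> 'o \<Rightarrow> 'm \<Rightarrow> 'o \<Rightarrow> 'm \<Rightarrow> bool" where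
  "is_kernel C X Y f K k \<longleftrightarrow> K \<in> Obj C \<and> k \<in> arr C K X \<and>
     Comp C f k = \<one>\<^bsub>Hom C K Y\<^esub> \<and>
     (\<forall>W\<in>Obj C. \<forall>u\<in>arr C W X. Comp C f u = \<one>\<^bsub>Hom C W Y\<^esub> \<longrightarrow>
        (\<exists>!v. v \<in> arr C W K \<and> Comp C k v = u))"

definition is_cokernel :: "('o, 'm) ab_cat \<Rightarrow> 'o \<Rightarrow> 'o \<Rightarrow> 'm \<Rightarrow> 'o \<Rightarrow> 'm \<Rightarrow> bool" where
  "is_cokernel C X Y f Q q \<longleftrightarrow> Q \<in> Obj C \<and> q \<in> arr C Y Q \<and>
     Comp C q f = \<one>\<^bsub>Hom C X Q\<^esub> \<and>
     (\<forall>Z\<in>Obj C. \<forall>u\<in>arr C Y Z. Comp C u f = \<one>\<^bsub>Hom C X Z\<^esub> \<longrightarrow>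
        (\<exists>!v. v \<in> arr C Q Z \<and> Comp C v q = u))"

locale abelian_category = preadditive_category +
  assumes zero_object_exists: "\<exists>Z. zero_object C Z"
    and biproduct_exists:
      "\<lbrakk>X \<in> Obj C; Y \<in> Obj C\<rbrakk> \<Longrightarrow> \<exists>S i\<^sub>1 i\<^sub>2 p\<^sub>1 p\<^sub>2. biproduct C X Y S i\<^sub>1 i\<^sub>2 p\<^sub>1 p\<^sub>2"
    and kernel_exists:
      "\<lbrakk>X \<in> Obj C; Y \<in> Obj C; f \<in> arr C X Y\<rbrakk> \<Longrightarrow> \<exists>K k. is_kernel C X Y f K k"
    and cokernel_exists:
      "\<lbrakk>X \<in> Obj C; Y \<in> Obj C; f \<in> arr C X Y\<rbrakk> \<Longrightarrow> \<exists>Q q. is_cokernel C X Y f Q q"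
    and monic_normal:
      "\<lbrakk>K \<in> Obj C; X \<in> Obj C; monic C K X k\<rbrakk>
        \<Longrightarrow> \<exists>Y f. Y \<in> Obj C \<and> f \<in> arr C X Y \<and> is_kernel C X Y f K k"
    and epic_normal:
      "\<lbrakk>Y \<in> Obj C; Q \<in> Obj C; epic C Y Q q\<rbrakk>
        \<Longrightarrow> \<exists>X f. X \<in> Obj C \<and> f \<in> arr C X Y \<and> is_cokernel C X Y f Q q"

definition projective :: "('o, 'm) ab_cat \<Rightarrow> 'o \<Rightarrow> bool" where
  "projective C P \<longleftrightarrow> P \<in> Obj C \<and>
     (\<forall>X\<in>Obj C. \<forall>Y\<in>Obj C. \<forall>e f. epic C X Y e \<and> f \<in> arr C P Y \<longrightarrow>
        (\<exists>g\<in>arr C P X. Comp C e g = f))"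

definition enough_projectives :: "('o, 'm) ab_cat \<Rightarrow> bool" where
  "enough_projectives C \<longleftrightarrow> (\<forall>X\<in>Obj C. \<exists>P e. projective C P \<and> epic C P X e)"


section \<open>Contravariant functors to abelian groups\<close>

text \<open>
  The type \<open>'v\<close> is the universe of the groups in \<open>Ab\<close>: all groups carried by subsets of \<open>'v\<close>.
  If every \<open>arr C X Y\<close> injects into \<open>'v\<close> (for instance \<open>'v = 'm\<close>), then so do the quotients of
  hom-groups, and every finitely presented functor has an isomorphic copy over \<open>'v\<close>.
  Natural transformations may relate functors over different universes. For a morphism
  \<open>f\<close> from \<open>X\<close> to \<open>Y\<close>, \<open>FMor F f\<close> maps \<open>FOb F Y\<close> to \<open>FOb F X\<close>; its values outside
  the carrier of \<open>FOb F Y\<close> are irrelevant.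
\<close>

record ('o, 'm, 'v) ab_functor =
  FOb :: "'o \<Rightarrow> 'v monoid"
  FMor :: "'m \<Rightarrow> 'v \<Rightarrow> 'v"

definition is_functor :: "('o, 'm) ab_cat \<Rightarrow> ('o, 'm, 'v) ab_functor \<Rightarrow> bool" where
  "is_functor C F \<longleftrightarrow>
     (\<forall>X\<in>Obj C. comm_group (FOb F X)) \<and>
     (\<forall>X\<in>Obj C. \<forall>Y\<in>Obj C. \<forall>f\<in>arr C X Y. FMor F f \<in> hom (FOb F Y) (FOb F X)) \<and>
     (\<forall>X\<in>Obj C. \<forall>x\<in>carrier (FOb F X). FMor F (Id C X) x = x) \<and>
     (\<forall>X\<in>Obj C. \<forall>Y\<in>Obj C. \<forall>Z\<in>Obj C. \<forall>f\<in>arr C X Y. \<forall>g\<in>arr C Y Z.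
        \<forall>x\<in>carrier (FOb F Z). FMor F (Comp C g f) x = FMor F f (FMor F g x))"

text \<open>
  The group of natural transformations. Components are made extensional so that two of them
  are equal as soon as they agree on the objects and on the carriers.
\<close>

definition nat_group ::
  "('o, 'm) ab_cat \<Rightarrow> ('o, 'm, 'v) ab_functor \<Rightarrow> ('o, 'm, 'w) ab_functor \<Rightarrow> ('o \<Rightarrow> 'v \<Rightarrow> 'w) monoid"
where
  "nat_group C F G =
    \<lparr>carrier =
       {\<eta> \<in> (\<Pi>\<^sub>E X\<in>Obj C. hom (FOb F X) (FOb G X) \<inter> extensional (carrier (FOb F X))).
          \<forall>X\<in>Obj C. \<forall>Y\<in>Obj C. \<forall>f\<in>arr C X Y. \<forall>y\<in>carrier (FOb F Y).
            \<eta> X (FMor F f y) = FMor G f (\<eta> Y y)},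
     mult = (\<lambda>\<eta> \<theta>. \<lambda>X\<in>Obj C. \<lambda>x\<in>carrier (FOb F X). \<eta> X x \<otimes>\<^bsub>FOb G X\<^esub> \<theta> X x),
     one = (\<lambda>X\<in>Obj C. \<lambda>x\<in>carrier (FOb F X). \<one>\<^bsub>FOb G X\<^esub>)\<rparr>"

definition nat_iso ::
  "('o, 'm) ab_cat \<Rightarrow> ('o, 'm, 'v) ab_functor \<Rightarrow> ('o, 'm, 'w) ab_functor \<Rightarrow> bool" where
  "nat_iso C F G \<longleftrightarrow>
     (\<exists>\<eta>\<in>carrier (nat_group C F G). \<forall>X\<in>Obj C. \<eta> X \<in> iso (FOb F X) (FOb G X))"

definition hom_functor :: "('o, 'm) ab_cat \<Rightarrow> 'o \<Rightarrow> ('o, 'm, 'm) ab_functor" where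
  "hom_functor C A = \<lparr>FOb = (\<lambda>X. Hom C X A), FMor = (\<lambda>f u. Comp C u f)\<rparr>"

text \<open>Exactness of a sequence of functors is exactness at every object.\<close>

definition fp :: "('o, 'm) ab_cat \<Rightarrow> ('o, 'm, 'v) ab_functor set" where
  "fp C = {F. is_functor C F \<and>
     (\<exists>A\<in>Obj C. \<exists>B\<in>Obj C.
        \<exists>\<alpha>\<in>carrier (nat_group C (hom_functor C A) (hom_functor C B)).
        \<exists>\<pi>\<in>carrier (nat_group C (hom_functor C B) F).
          \<forall>X\<in>Obj C.
            \<alpha> X ` arr C X A = kernel (Hom C X B) (FOb F X) (\<pi> X) \<and>
            \<pi> X ` arr C X B = carrier (FOb F X))}"

definition fp0 :: "('o, 'm) ab_cat \<Rightarrow> ('o, 'm, 'v) ab_functor set" where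
  "fp0 C = {F \<in> fp C. \<forall>P. projective C P \<longrightarrow> trivial_group (FOb F P)}"

definition proj_factoring :: "('o, 'm) ab_cat \<Rightarrow> 'o \<Rightarrow> 'o \<Rightarrow> 'm set" where
  "proj_factoring C B A =
     {f \<in> arr C B A. \<exists>P. projective C P \<and>
        (\<exists>g\<in>arr C B P. \<exists>h\<in>arr C P A. f = Comp C h g)}"

definition proj_functor :: "('o, 'm) ab_cat \<Rightarrow> 'o \<Rightarrow> ('o, 'm, 'm) ab_functor" where
  "proj_functor C A =
     \<lparr>FOb = (\<lambda>X. (Hom C X A)\<lparr>carrier := proj_factoring C X A\<rparr>), FMor = (\<lambda>f u. Comp C u f)\<rparr>"

definition fp_shriek_star :: "('o, 'm) ab_cat \<Rightarrow> ('o, 'm, 'v) ab_functor set" where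
  "fp_shriek_star C = {F \<in> fp C. \<exists>A\<in>Obj C. nat_iso C F (proj_functor C A)}"

end

theory Submission
  imports Defs
begin

text \<open>
  Every functor \<open>F\<close> isomorphic to some \<open>P(-,A)\<close> is orthogonal to the functors \<open>G\<close> that vanish on
  projectives, and this is an element chase. For \<open>G \<rightarrow> F\<close>, restrict along an epimorphism \<open>P \<rightarrow> X\<close> with
  \<open>P\<close> projective: \<open>G X \<rightarrow> F P\<close> factors through \<open>G P = 0\<close>, while \<open>F X \<rightarrow> F P\<close> is injective because \<open>F\<close>
  embeds in \<open>Hom(-,A)\<close>. For \<open>F \<rightarrow> G\<close>, every element of \<open>F X\<close> is the restriction of an element of some
  \<open>F P\<close> with \<open>P\<close> projective, and that element goes to \<open>G P = 0\<close>. These are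
  \<open>proj_functor_receives_zero\<close> and \<open>proj_functor_emits_zero\<close>.

  Conversely, let \<open>F\<close> be the cokernel of \<open>Hom(-,f)\<close> for \<open>f : A \<rightarrow> B\<close>. By the Yoneda lemma \<open>F\<close> is
  generated by one element \<open>e\<close> of \<open>F B\<close>, and \<open>u\<close> annihilates \<open>e\<close> exactly when it factors through
  \<open>f\<close>. Let \<open>q : B \<rightarrow> Q\<close> be the cokernel of \<open>f\<close>, and factor \<open>f\<close> as an epimorphism \<open>f' : A \<rightarrow> I\<close>
  followed by the kernel \<open>i\<close> of \<open>q\<close>. The subfunctor of \<open>F\<close> generated by \<open>F i e\<close> is the cokernel of
  \<open>Hom(-,f')\<close>; it vanishes on projectives because \<open>f'\<close> is epic. If \<open>F\<close> receives no nonzero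
  transformation from such functors, this subfunctor is zero, so \<open>u\<close> annihilates \<open>e\<close> exactly when
  \<open>q \<circ> u = 0\<close> (\<open>annihilator_of_generator\<close>). Hence \<open>F X\<close> is, up to isomorphism, the group of the morphisms \<open>X \<rightarrow> Q\<close>
  that factor through \<open>q\<close>; it contains \<open>P(X,Q)\<close>, since \<open>q\<close> is epic.

  Next take an epimorphism \<open>c : P \<rightarrow> Q\<close> with \<open>P\<close> projective and write \<open>c = q \<circ> r\<close>. The quotient of \<open>F\<close>
  by the subfunctor generated by \<open>F r e\<close> is finitely presented, by \<open>(f, r) : A \<oplus> P \<rightarrow> B\<close>, and it
  vanishes on projectives because morphisms from a projective to \<open>Q\<close> lift along \<open>c\<close>. If \<open>F\<close> maps to
  such functors only by zero, the quotient is zero (\<open>generated_by_projective\<close>), so every morphism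
  \<open>X \<rightarrow> Q\<close> that factors through \<open>q\<close> factors through \<open>c\<close>, whence \<open>F \<cong> P(-,Q)\<close>.

  Both test functors are built from \<open>F\<close> alone, a subfunctor and a quotient. A quotient can be
  realised on a choice of coset representatives, so both have values in the same type as \<open>F\<close>, and
  the argument works for any type of group elements.
\<close>

section \<open>Natural transformations without extensionality\<close>

text \<open>
  Composites and restrictions of extensional families need constant repair. Since extensionality
  matters only for the equality of transformations, it is confined to the two equivalences
  \<open>trivial_nat_group_iff\<close> and \<open>nat_iso_iff\<close>.
\<close>

definition natural ::
  "('o, 'm) ab_cat \<Rightarrow> ('o, 'm, 'v) ab_functor \<Rightarrow> ('o, 'm, 'w) ab_functor \<Rightarrow> ('o \<Rightarrow> 'v \<Rightarrow> 'w) \<Rightarrow> bool"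
where
  "natural C F G h \<longleftrightarrow>
     (\<forall>X\<in>Obj C. h X \<in> hom (FOb F X) (FOb G X)) \<and>
     (\<forall>X\<in>Obj C. \<forall>Y\<in>Obj C. \<forall>f\<in>arr C X Y. \<forall>y\<in>carrier (FOb F Y).
        h X (FMor F f y) = FMor G f (h Y y))"

lemma natural_hom: "natural C F G h \<Longrightarrow> X \<in> Obj C \<Longrightarrow> h X \<in> hom (FOb F X) (FOb G X)"
  by (simp add: natural_def)

lemma natural_closed:
  "natural C F G h \<Longrightarrow> X \<in> Obj C \<Longrightarrow> x \<in> carrier (FOb F X) \<Longrightarrow> h X x \<in> carrier (FOb G X)"
  by (auto simp: natural_def hom_def)

lemma natural_comm:
  "natural C F G h \<Longrightarrow> X \<in> Obj C \<Longrightarrow> Y \<in> Obj C \<Longrightarrow> f \<in> arr C X Y \<Longrightarrow> y \<in> carrier (FOb F Y)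
    \<Longrightarrow> h X (FMor F f y) = FMor G f (h Y y)"
  by (simp add: natural_def)

lemma functor_group: "is_functor C F \<Longrightarrow> X \<in> Obj C \<Longrightarrow> comm_group (FOb F X)"
  by (simp add: is_functor_def)

lemma functor_hom:
  "is_functor C F \<Longrightarrow> X \<in> Obj C \<Longrightarrow> Y \<in> Obj C \<Longrightarrow> f \<in> arr C X Y
    \<Longrightarrow> FMor F f \<in> hom (FOb F Y) (FOb F X)"
  by (simp add: is_functor_def)

lemma functor_closed:
  "is_functor C F \<Longrightarrow> X \<in> Obj C \<Longrightarrow> Y \<in> Obj C \<Longrightarrow> f \<in> arr C X Y \<Longrightarrow> y \<in> carrier (FOb F Y)
    \<Longrightarrow> FMor F f y \<in> carrier (FOb F X)"
  using functor_hom by (fastforce simp: hom_def)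

lemma functor_id:
  "is_functor C F \<Longrightarrow> X \<in> Obj C \<Longrightarrow> x \<in> carrier (FOb F X) \<Longrightarrow> FMor F (Id C X) x = x"
  by (simp add: is_functor_def)

lemma functor_comp:
  "is_functor C F \<Longrightarrow> X \<in> Obj C \<Longrightarrow> Y \<in> Obj C \<Longrightarrow> Z \<in> Obj C \<Longrightarrow> f \<in> arr C X Y \<Longrightarrow> g \<in> arr C Y Z
    \<Longrightarrow> x \<in> carrier (FOb F Z) \<Longrightarrow> FMor F (Comp C g f) x = FMor F f (FMor F g x)"
  by (simp add: is_functor_def)

lemma functor_one:
  assumes "is_functor C F" "X \<in> Obj C" "Y \<in> Obj C" "f \<in> arr C X Y"
  shows "FMor F f \<one>\<^bsub>FOb F Y\<^esub> = \<one>\<^bsub>FOb F X\<^esub>"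
  by (meson assms comm_group.axioms(2) functor_group functor_hom hom_one)

lemma natural_one:
  assumes "is_functor C F" "is_functor C G" "natural C F G h" "X \<in> Obj C"
  shows "h X \<one>\<^bsub>FOb F X\<^esub> = \<one>\<^bsub>FOb G X\<^esub>"
  by (meson assms comm_group.axioms(2) functor_group natural_hom hom_one)

lemma nat_group_natural: "\<eta> \<in> carrier (nat_group C F G) \<Longrightarrow> natural C F G \<eta>"
  by (auto simp: nat_group_def natural_def PiE_iff)

lemma restrict_in_nat_group:
  assumes F: "is_functor C F" and h: "natural C F G h"
  shows "(\<lambda>X\<in>Obj C. restrict (h X) (carrier (FOb F X))) \<in> carrier (nat_group C F G)"
proof -
  have "restrict (h X) (carrier (FOb F X)) \<in> hom (FOb F X) (FOb G X)" if "X \<in> Obj C" for X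
  proof -
    interpret comm_group "FOb F X" by (rule functor_group[OF F that])
    show ?thesis using natural_hom[OF h that] by (auto simp: hom_def Pi_iff)
  qed
  then show ?thesis
    by (auto simp: nat_group_def functor_closed[OF F] natural_comm[OF h])
qed

lemma trivial_nat_group_iff:
  assumes F: "is_functor C F" and G: "is_functor C G"
  shows "trivial_group (nat_group C F G) \<longleftrightarrow>
    (\<forall>h. natural C F G h \<longrightarrow> (\<forall>X\<in>Obj C. \<forall>x\<in>carrier (FOb F X). h X x = \<one>\<^bsub>FOb G X\<^esub>))"
    (is "_ \<longleftrightarrow> ?R")
proof
  assume T: "trivial_group (nat_group C F G)"
  show ?R
  proof (intro allI impI ballI)
    fix h X x assume h: "natural C F G h" and X: "X \<in> Obj C" and x: "x \<in> carrier (FOb F X)"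
    have "(\<lambda>X\<in>Obj C. restrict (h X) (carrier (FOb F X))) = \<one>\<^bsub>nat_group C F G\<^esub>"
      using T restrict_in_nat_group[OF F h] by (auto simp: trivial_group_def)
    then have "(\<lambda>X\<in>Obj C. restrict (h X) (carrier (FOb F X))) X x = \<one>\<^bsub>nat_group C F G\<^esub> X x"
      by simp
    then show "h X x = \<one>\<^bsub>FOb G X\<^esub>" using X x by (simp add: nat_group_def)
  qed
next
  assume R: ?R
  let ?N = "nat_group C F G"
  have G1: "comm_group (FOb G X)" if "X \<in> Obj C" for X using functor_group[OF G that] .
  have "natural C F G (\<lambda>X x. \<one>\<^bsub>FOb G X\<^esub>)"
    unfolding natural_def using G1
    by (auto simp: functor_one[OF G] hom_def comm_group_def group.is_monoid)
  from restrict_in_nat_group[OF F this] have one: "\<one>\<^bsub>?N\<^esub> \<in> carrier ?N"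
    by (simp add: nat_group_def restrict_def)
  have sub: "\<eta> = \<one>\<^bsub>?N\<^esub>" if "\<eta> \<in> carrier ?N" for \<eta>
  proof (rule ext)
    fix X
    have *: "\<eta> \<in> extensional (Obj C)" "X \<in> Obj C \<Longrightarrow> \<eta> X \<in> extensional (carrier (FOb F X))"
      using that by (auto simp: nat_group_def PiE_iff)
    show "\<eta> X = \<one>\<^bsub>?N\<^esub> X"
    proof (cases "X \<in> Obj C")
      case True
      show ?thesis
      proof (rule extensionalityI[OF *(2)[OF True]])
        show "\<one>\<^bsub>?N\<^esub> X \<in> extensional (carrier (FOb F X))"
          using True by (simp add: nat_group_def)
        fix x assume x: "x \<in> carrier (FOb F X)"
        have "\<eta> X x = \<one>\<^bsub>FOb G X\<^esub>"
          using R nat_group_natural[OF that] True x by blast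
        then show "\<eta> X x = \<one>\<^bsub>?N\<^esub> X x" using True x by (simp add: nat_group_def)
      qed
    next
      case False
      then show ?thesis using extensional_arb[OF *(1)] by (simp add: nat_group_def)
    qed
  qed
  have car: "carrier ?N = {\<one>\<^bsub>?N\<^esub>}" using one sub by blast
  have "\<one>\<^bsub>FOb G X\<^esub> \<otimes>\<^bsub>FOb G X\<^esub> \<one>\<^bsub>FOb G X\<^esub> = \<one>\<^bsub>FOb G X\<^esub>" if "X \<in> Obj C" for X
  proof -
    interpret comm_group "FOb G X" by (rule G1[OF that])
    show ?thesis by simp
  qed
  then have mult: "\<one>\<^bsub>?N\<^esub> \<otimes>\<^bsub>?N\<^esub> \<one>\<^bsub>?N\<^esub> = \<one>\<^bsub>?N\<^esub>"
    by (simp add: nat_group_def fun_eq_iff restrict_def)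
  have "group ?N" by (rule groupI) (auto simp: car mult)
  then show "trivial_group ?N" by (simp add: trivial_group_def car)
qed

lemma nat_iso_iff:
  assumes F: "is_functor C F"
  shows "nat_iso C F G \<longleftrightarrow>
    (\<exists>h. natural C F G h \<and> (\<forall>X\<in>Obj C. bij_betw (h X) (carrier (FOb F X)) (carrier (FOb G X))))"
proof
  assume "nat_iso C F G"
  then show "\<exists>h. natural C F G h \<and> (\<forall>X\<in>Obj C. bij_betw (h X) (carrier (FOb F X)) (carrier (FOb G X)))"
    unfolding nat_iso_def iso_def using nat_group_natural by blast
next
  assume "\<exists>h. natural C F G h \<and> (\<forall>X\<in>Obj C. bij_betw (h X) (carrier (FOb F X)) (carrier (FOb G X)))"
  then obtain h where h: "natural C F G h"
    and b: "\<And>X. X \<in> Obj C \<Longrightarrow> bij_betw (h X) (carrier (FOb F X)) (carrier (FOb G X))" by blast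
  let ?h = "\<lambda>X\<in>Obj C. restrict (h X) (carrier (FOb F X))"
  have r: "?h \<in> carrier (nat_group C F G)" by (rule restrict_in_nat_group[OF F h])
  have "bij_betw (?h X) (carrier (FOb F X)) (carrier (FOb G X))" if "X \<in> Obj C" for X
  proof -
    have "bij_betw (?h X) (carrier (FOb F X)) (carrier (FOb G X)) \<longleftrightarrow>
        bij_betw (h X) (carrier (FOb F X)) (carrier (FOb G X))"
      by (rule bij_betw_cong) (simp add: that)
    then show ?thesis using b[OF that] by blast
  qed
  then have "?h X \<in> iso (FOb F X) (FOb G X)" if "X \<in> Obj C" for X
    using natural_hom[OF nat_group_natural[OF r] that] that by (simp add: iso_def)
  then show "nat_iso C F G" unfolding nat_iso_def using r by blast
qed

section \<open>Preadditive categories\<close>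

text \<open>
  Turns a description of the elements killed by \<open>h\<close> into a description of the pairs that \<open>h\<close>
  identifies.
\<close>

lemma hom_eq_iff:
  assumes "group G" "group H" "h \<in> hom G H" "x \<in> carrier G" "y \<in> carrier G"
  shows "h x = h y \<longleftrightarrow> h (x \<otimes>\<^bsub>G\<^esub> inv\<^bsub>G\<^esub> y) = \<one>\<^bsub>H\<^esub>"
proof -
  interpret group_hom G H h using assms by (simp add: group_hom_def group_hom_axioms_def)
  show ?thesis using assms by (simp add: H.inv_solve_right')
qed

context preadditive_category
begin

lemma comp_hom_left:
  "X \<in> Obj C \<Longrightarrow> Y \<in> Obj C \<Longrightarrow> Z \<in> Obj C \<Longrightarrow> g \<in> arr C Y Z \<Longrightarrow>
    Comp C g \<in> hom (Hom C X Y) (Hom C X Z)"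
  by (auto simp: hom_def comp_closed comp_add_right)

lemma comp_hom_right:
  "X \<in> Obj C \<Longrightarrow> Y \<in> Obj C \<Longrightarrow> Z \<in> Obj C \<Longrightarrow> f \<in> arr C X Y \<Longrightarrow>
    (\<lambda>g. Comp C g f) \<in> hom (Hom C Y Z) (Hom C X Z)"
  by (auto simp: hom_def comp_closed comp_add_left)

lemma hom_group: "X \<in> Obj C \<Longrightarrow> Y \<in> Obj C \<Longrightarrow> group (Hom C X Y)"
  using hom_comm_group comm_group.axioms(2) by blast

lemma comp_zero:
  assumes "X \<in> Obj C" "Y \<in> Obj C" "Z \<in> Obj C" "g \<in> arr C Y Z"
  shows "Comp C g \<one>\<^bsub>Hom C X Y\<^esub> = \<one>\<^bsub>Hom C X Z\<^esub>"
  by (rule hom_one[OF comp_hom_left[OF assms]]) (use assms hom_group in auto)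

lemma zero_comp:
  assumes "X \<in> Obj C" "Y \<in> Obj C" "Z \<in> Obj C" "f \<in> arr C X Y"
  shows "Comp C \<one>\<^bsub>Hom C Y Z\<^esub> f = \<one>\<^bsub>Hom C X Z\<^esub>"
  by (rule hom_one[OF comp_hom_right[OF assms]]) (use assms hom_group in auto)

lemma minus_comp:
  assumes "X \<in> Obj C" "Y \<in> Obj C" "Z \<in> Obj C" "g \<in> arr C Y Z" "f \<in> arr C X Y"
  shows "Comp C (inv\<^bsub>Hom C Y Z\<^esub> g) f = inv\<^bsub>Hom C X Z\<^esub> (Comp C g f)"
proof -
  interpret group_hom "Hom C Y Z" "Hom C X Z" "\<lambda>g. Comp C g f"
    using assms by (simp add: group_hom_def group_hom_axioms_def hom_group comp_hom_right)
  show ?thesis using assms by simp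
qed

lemma epicI_zero:
  assumes "X \<in> Obj C" "Y \<in> Obj C" and f: "f \<in> arr C X Y"
    and z: "\<And>Z z. Z \<in> Obj C \<Longrightarrow> z \<in> arr C Y Z \<Longrightarrow> Comp C z f = \<one>\<^bsub>Hom C X Z\<^esub> \<Longrightarrow> z = \<one>\<^bsub>Hom C Y Z\<^esub>"
  shows "epic C X Y f"
  unfolding epic_def
proof (intro conjI ballI impI f)
  fix Z u v assume a: "Z \<in> Obj C" "u \<in> arr C Y Z" "v \<in> arr C Y Z" "Comp C u f = Comp C v f"
  interpret g: group "Hom C Y Z" using assms a by (simp add: hom_group)
  interpret h: group "Hom C X Z" using assms a by (simp add: hom_group)
  have "Comp C (u \<otimes>\<^bsub>Hom C Y Z\<^esub> inv\<^bsub>Hom C Y Z\<^esub> v) f = \<one>\<^bsub>Hom C X Z\<^esub>"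
    using assms a by (simp add: comp_add_left minus_comp comp_closed)
  then have "u \<otimes>\<^bsub>Hom C Y Z\<^esub> inv\<^bsub>Hom C Y Z\<^esub> v = \<one>\<^bsub>Hom C Y Z\<^esub>" using z a by simp
  then show "u = v" using a g.inv_equality g.inv_inv by fastforce
qed

lemma cokernel_epic:
  assumes "X \<in> Obj C" "Y \<in> Obj C" "f \<in> arr C X Y" "is_cokernel C X Y f Q q"
  shows "epic C Y Q q"
  unfolding epic_def
proof (intro conjI ballI impI)
  show q: "q \<in> arr C Y Q" using assms by (simp add: is_cokernel_def)
  have Q: "Q \<in> Obj C" using assms by (simp add: is_cokernel_def)
  fix Z u v assume a: "Z \<in> Obj C" "u \<in> arr C Q Z" "v \<in> arr C Q Z" "Comp C u q = Comp C v q"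
  have "Comp C (Comp C u q) f = Comp C u (Comp C q f)"
    using comp_assoc[of X Y Q Z f q u] assms(1-3) Q q a by simp
  also have "\<dots> = \<one>\<^bsub>Hom C X Z\<^esub>"
    using assms comp_zero[OF assms(1) Q a(1,2)] by (simp add: is_cokernel_def)
  finally have "\<exists>!w. w \<in> arr C Q Z \<and> Comp C w q = Comp C u q"
    using assms a comp_closed[OF assms(2) Q a(1) q a(2)] unfolding is_cokernel_def by blast
  then show "u = v" using a by metis
qed

lemma kernel_cancel:
  assumes "X \<in> Obj C" "Y \<in> Obj C" "f \<in> arr C X Y" "is_kernel C X Y f K k"
    "W \<in> Obj C" "u \<in> arr C W K" "v \<in> arr C W K" "Comp C k u = Comp C k v"
  shows "u = v"
proof -
  have k: "K \<in> Obj C" "k \<in> arr C K X" using assms by (auto simp: is_kernel_def)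
  have "Comp C f (Comp C k u) = Comp C (Comp C f k) u"
    using comp_assoc[of W K X Y u k f] assms k by simp
  also have "\<dots> = \<one>\<^bsub>Hom C W Y\<^esub>"
    using assms zero_comp[OF assms(5) k(1) assms(2,6)] by (simp add: is_kernel_def)
  finally have "\<exists>!w. w \<in> arr C W K \<and> Comp C k w = Comp C k u"
    using assms comp_closed[OF assms(5) k(1) assms(1,6) k(2)] unfolding is_kernel_def by blast
  then show ?thesis using assms by metis
qed

text \<open>
  The definition of a biproduct leaves the mixed composites implicit. Composing the decomposition of
  the identity with \<open>p\<^sub>1\<close> gives \<open>p\<^sub>1 = p\<^sub>1 + p\<^sub>1 i\<^sub>2 p\<^sub>2\<close>, and \<open>p\<^sub>2\<close> is split epic.
\<close>

lemma biproduct_cross: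
  assumes X: "X \<in> Obj C" and Y: "Y \<in> Obj C" and b: "biproduct C X Y S i\<^sub>1 i\<^sub>2 p\<^sub>1 p\<^sub>2"
  shows "Comp C p\<^sub>1 i\<^sub>2 = \<one>\<^bsub>Hom C Y X\<^esub>"
proof -
  have S: "S \<in> Obj C" and i1: "i\<^sub>1 \<in> arr C X S" and i2: "i\<^sub>2 \<in> arr C Y S"
    and p1: "p\<^sub>1 \<in> arr C S X" and p2: "p\<^sub>2 \<in> arr C S Y"
    and e1: "Comp C p\<^sub>1 i\<^sub>1 = Id C X" and e2: "Comp C p\<^sub>2 i\<^sub>2 = Id C Y"
    and e: "Comp C i\<^sub>1 p\<^sub>1 \<otimes>\<^bsub>Hom C S S\<^esub> Comp C i\<^sub>2 p\<^sub>2 = Id C S"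
    using b by (auto simp: biproduct_def)
  interpret SX: group "Hom C S X" by (rule hom_group[OF S X])
  have i1p1: "Comp C i\<^sub>1 p\<^sub>1 \<in> arr C S S" by (rule comp_closed[OF S X S p1 i1])
  have i2p2: "Comp C i\<^sub>2 p\<^sub>2 \<in> arr C S S" by (rule comp_closed[OF S Y S p2 i2])
  have p1i2: "Comp C p\<^sub>1 i\<^sub>2 \<in> arr C Y X" by (rule comp_closed[OF Y S X i2 p1])
  have z: "Comp C (Comp C p\<^sub>1 i\<^sub>2) p\<^sub>2 \<in> arr C S X" by (rule comp_closed[OF S Y X p2 p1i2])
  have "p\<^sub>1 = Comp C p\<^sub>1 (Comp C i\<^sub>1 p\<^sub>1 \<otimes>\<^bsub>Hom C S S\<^esub> Comp C i\<^sub>2 p\<^sub>2)"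
    by (simp add: e id_right[OF S X p1])
  also have "\<dots> = Comp C p\<^sub>1 (Comp C i\<^sub>1 p\<^sub>1) \<otimes>\<^bsub>Hom C S X\<^esub> Comp C p\<^sub>1 (Comp C i\<^sub>2 p\<^sub>2)"
    by (rule comp_add_right[OF S S X i1p1 i2p2 p1])
  also have "\<dots> = p\<^sub>1 \<otimes>\<^bsub>Hom C S X\<^esub> Comp C (Comp C p\<^sub>1 i\<^sub>2) p\<^sub>2"
    by (simp add: comp_assoc[OF S X S X p1 i1 p1] comp_assoc[OF S Y S X p2 i2 p1] e1 id_left[OF S X p1])
  finally have "Comp C (Comp C p\<^sub>1 i\<^sub>2) p\<^sub>2 = \<one>\<^bsub>Hom C S X\<^esub>"
    using SX.l_cancel_one'[OF p1 z] by simp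
  then have "Comp C (Comp C (Comp C p\<^sub>1 i\<^sub>2) p\<^sub>2) i\<^sub>2 = \<one>\<^bsub>Hom C Y X\<^esub>"
    by (simp add: zero_comp[OF Y S X i2])
  then show ?thesis
    by (simp add: comp_assoc[OF Y S Y X i2 p2 p1i2, symmetric] e2 id_right[OF Y X p1i2])
qed

text \<open>
  The morphism \<open>(f, r)\<close> out of a biproduct is \<open>f p\<^sub>1 + r p\<^sub>2\<close>; a morphism factors through it exactly
  when it is a sum of one that factors through \<open>f\<close> and one that factors through \<open>r\<close>.
\<close>

lemma biproduct_copair:
  assumes A: "A \<in> Obj C" and K: "K \<in> Obj C" and B: "B \<in> Obj C" and X: "X \<in> Obj C"
    and f: "f \<in> arr C A B" and r: "r \<in> arr C K B" and b: "biproduct C A K S i\<^sub>1 i\<^sub>2 p\<^sub>1 p\<^sub>2"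
  shows "Comp C f p\<^sub>1 \<otimes>\<^bsub>Hom C S B\<^esub> Comp C r p\<^sub>2 \<in> arr C S B"
    and "(\<exists>w\<in>arr C X S. u = Comp C (Comp C f p\<^sub>1 \<otimes>\<^bsub>Hom C S B\<^esub> Comp C r p\<^sub>2) w) \<longleftrightarrow>
      (\<exists>a\<in>arr C X A. \<exists>b\<in>arr C X K. u = Comp C f a \<otimes>\<^bsub>Hom C X B\<^esub> Comp C r b)"
proof -
  have S: "S \<in> Obj C" and i1: "i\<^sub>1 \<in> arr C A S" and i2: "i\<^sub>2 \<in> arr C K S"
    and p1: "p\<^sub>1 \<in> arr C S A" and p2: "p\<^sub>2 \<in> arr C S K"
    and e1: "Comp C p\<^sub>1 i\<^sub>1 = Id C A" and e2: "Comp C p\<^sub>2 i\<^sub>2 = Id C K"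
    using b by (auto simp: biproduct_def)
  have b': "biproduct C K A S i\<^sub>2 i\<^sub>1 p\<^sub>2 p\<^sub>1"
  proof -
    interpret SS: comm_group "Hom C S S" by (rule hom_comm_group[OF S S])
    show ?thesis
      using b SS.m_comm[OF comp_closed[OF S A S p1 i1] comp_closed[OF S K S p2 i2]]
      by (simp add: biproduct_def)
  qed
  interpret SB: group "Hom C S B" by (rule hom_group[OF S B])
  interpret XS: group "Hom C X S" by (rule hom_group[OF X S])
  interpret XA: group "Hom C X A" by (rule hom_group[OF X A])
  interpret XK: group "Hom C X K" by (rule hom_group[OF X K])
  let ?g = "Comp C f p\<^sub>1 \<otimes>\<^bsub>Hom C S B\<^esub> Comp C r p\<^sub>2"
  have fp: "Comp C f p\<^sub>1 \<in> arr C S B" and rp: "Comp C r p\<^sub>2 \<in> arr C S B"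
    using comp_closed[OF S A B p1 f] comp_closed[OF S K B p2 r] by auto
  then show "?g \<in> arr C S B" by simp
  have g: "Comp C ?g w = Comp C f (Comp C p\<^sub>1 w) \<otimes>\<^bsub>Hom C X B\<^esub> Comp C r (Comp C p\<^sub>2 w)"
    if w: "w \<in> arr C X S" for w
    by (simp add: comp_add_left[OF X S B w fp rp] comp_assoc[OF X S A B w p1 f] comp_assoc[OF X S K B w p2 r])
  have pair: "\<exists>w\<in>arr C X S. Comp C p\<^sub>1 w = a \<and> Comp C p\<^sub>2 w = b"
    if a: "a \<in> arr C X A" and bb: "b \<in> arr C X K" for a b
  proof -
    have ia: "Comp C i\<^sub>1 a \<in> arr C X S" and ib: "Comp C i\<^sub>2 b \<in> arr C X S"
      using comp_closed[OF X A S a i1] comp_closed[OF X K S bb i2] by auto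
    have "Comp C p\<^sub>1 (Comp C i\<^sub>1 a \<otimes>\<^bsub>Hom C X S\<^esub> Comp C i\<^sub>2 b) = a"
      using a by (simp add: comp_add_right[OF X S A ia ib p1] comp_assoc[OF X A S A a i1 p1]
          comp_assoc[OF X K S A bb i2 p1] e1 biproduct_cross[OF A K b] id_left[OF X A a]
          zero_comp[OF X K A bb])
    moreover have "Comp C p\<^sub>2 (Comp C i\<^sub>1 a \<otimes>\<^bsub>Hom C X S\<^esub> Comp C i\<^sub>2 b) = b"
      using bb by (simp add: comp_add_right[OF X S K ia ib p2] comp_assoc[OF X A S K a i1 p2]
          comp_assoc[OF X K S K bb i2 p2] e2 biproduct_cross[OF K A b'] id_left[OF X K bb]
          zero_comp[OF X A K a])
    ultimately show ?thesis using XS.m_closed[OF ia ib] by blast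
  qed
  show "(\<exists>w\<in>arr C X S. u = Comp C ?g w) \<longleftrightarrow>
      (\<exists>a\<in>arr C X A. \<exists>b\<in>arr C X K. u = Comp C f a \<otimes>\<^bsub>Hom C X B\<^esub> Comp C r b)"
  proof
    assume "\<exists>w\<in>arr C X S. u = Comp C ?g w"
    then show "\<exists>a\<in>arr C X A. \<exists>b\<in>arr C X K. u = Comp C f a \<otimes>\<^bsub>Hom C X B\<^esub> Comp C r b"
      using g comp_closed[OF X S A _ p1] comp_closed[OF X S K _ p2] by blast
  next
    assume "\<exists>a\<in>arr C X A. \<exists>b\<in>arr C X K. u = Comp C f a \<otimes>\<^bsub>Hom C X B\<^esub> Comp C r b"
    then obtain a b where "a \<in> arr C X A" "b \<in> arr C X K"
      "u = Comp C f a \<otimes>\<^bsub>Hom C X B\<^esub> Comp C r b" by blast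
    with pair[of a b] g show "\<exists>w\<in>arr C X S. u = Comp C ?g w" by metis
  qed
qed

end

section \<open>Finite presentations by a generator\<close>

text \<open>
  The Yoneda form of an exact sequence \<open>Hom(-,A) \<rightarrow> Hom(-,B) \<rightarrow> F \<rightarrow> 0\<close>: the first transformation is
  composition with \<open>f\<close>, and the second sends \<open>u\<close> to \<open>F u e\<close>. The additivity clause is part of the
  data because \<open>is_functor\<close> does not ask a functor to be additive; it says that the second
  transformation consists of homomorphisms.
\<close>

definition presents ::
  "('o, 'm) ab_cat \<Rightarrow> ('o, 'm, 'v) ab_functor \<Rightarrow> 'o \<Rightarrow> 'o \<Rightarrow> 'm \<Rightarrow> 'v \<Rightarrow> bool" where
  "presents C F A B f e \<longleftrightarrow> A \<in> Obj C \<and> B \<in> Obj C \<and> f \<in> arr C A B \<and> e \<in> carrier (FOb F B) \<and>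
     (\<forall>X\<in>Obj C.
        (\<forall>u\<in>arr C X B. \<forall>v\<in>arr C X B.
           FMor F (u \<otimes>\<^bsub>Hom C X B\<^esub> v) e = FMor F u e \<otimes>\<^bsub>FOb F X\<^esub> FMor F v e) \<and>
        (\<forall>x\<in>carrier (FOb F X). \<exists>u\<in>arr C X B. x = FMor F u e) \<and>
        (\<forall>u\<in>arr C X B. FMor F u e = \<one>\<^bsub>FOb F X\<^esub> \<longleftrightarrow> (\<exists>w\<in>arr C X A. u = Comp C f w)))"

lemma presentsD:
  assumes "presents C F A B f e"
  shows "A \<in> Obj C" "B \<in> Obj C" "f \<in> arr C A B" "e \<in> carrier (FOb F B)"
    "\<And>X u v. X \<in> Obj C \<Longrightarrow> u \<in> arr C X B \<Longrightarrow> v \<in> arr C X B \<Longrightarrow>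
       FMor F (u \<otimes>\<^bsub>Hom C X B\<^esub> v) e = FMor F u e \<otimes>\<^bsub>FOb F X\<^esub> FMor F v e"
    "\<And>X x. X \<in> Obj C \<Longrightarrow> x \<in> carrier (FOb F X) \<Longrightarrow> \<exists>u\<in>arr C X B. x = FMor F u e"
    "\<And>X u. X \<in> Obj C \<Longrightarrow> u \<in> arr C X B \<Longrightarrow>
       FMor F u e = \<one>\<^bsub>FOb F X\<^esub> \<longleftrightarrow> (\<exists>w\<in>arr C X A. u = Comp C f w)"
  using assms unfolding presents_def by blast+

context preadditive_category
begin

lemma hom_functor_is_functor:
  assumes "A \<in> Obj C" shows "is_functor C (hom_functor C A)"
  using assms
  by (auto simp: is_functor_def hom_functor_def hom_comm_group comp_hom_right id_right comp_assoc)

text \<open>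
  The Yoneda lemma, with \<open>f\<close> and \<open>e\<close> the images of the identities of \<open>A\<close> and \<open>B\<close>.
\<close>

lemma fp_iff_presents:
  "F \<in> fp C \<longleftrightarrow> is_functor C F \<and> (\<exists>A B f e. presents C F A B f e)"
proof (intro iffI conjI; (elim conjE exE)?)
  assume F: "F \<in> fp C"
  then show F': "is_functor C F" by (simp add: fp_def)
  from F obtain A B \<alpha> \<pi> where AB: "A \<in> Obj C" "B \<in> Obj C"
    and "\<alpha> \<in> carrier (nat_group C (hom_functor C A) (hom_functor C B))"
    and "\<pi> \<in> carrier (nat_group C (hom_functor C B) F)"
    and ex: "\<forall>X\<in>Obj C. \<alpha> X ` arr C X A = kernel (Hom C X B) (FOb F X) (\<pi> X) \<and>
        \<pi> X ` arr C X B = carrier (FOb F X)"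
    unfolding fp_def mem_Collect_eq by (elim conjE bexE) (rule that)
  then have \<alpha>: "natural C (hom_functor C A) (hom_functor C B) \<alpha>" and \<pi>: "natural C (hom_functor C B) F \<pi>"
    by (auto intro: nat_group_natural)
  from ex have ker: "\<And>X. X \<in> Obj C \<Longrightarrow> \<alpha> X ` arr C X A = kernel (Hom C X B) (FOb F X) (\<pi> X)"
    and sur: "\<And>X. X \<in> Obj C \<Longrightarrow> \<pi> X ` arr C X B = carrier (FOb F X)"
    by simp_all
  define f e where "f = \<alpha> A (Id C A)" and "e = \<pi> B (Id C B)"
  have f: "f \<in> arr C A B"
    using natural_closed[OF \<alpha> AB(1), of "Id C A"] id_closed AB by (simp add: f_def hom_functor_def)
  have e: "e \<in> carrier (FOb F B)"
    using natural_closed[OF \<pi> AB(2), of "Id C B"] id_closed AB by (simp add: e_def hom_functor_def)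
  have yf: "\<alpha> X w = Comp C f w" if "X \<in> Obj C" "w \<in> arr C X A" for X w
    using natural_comm[OF \<alpha> that(1) AB(1) that(2), of "Id C A"] that AB
    by (simp add: hom_functor_def id_closed id_left f_def)
  have ye: "\<pi> X u = FMor F u e" if "X \<in> Obj C" "u \<in> arr C X B" for X u
    using natural_comm[OF \<pi> that(1) AB(2) that(2), of "Id C B"] that AB
    by (simp add: hom_functor_def id_closed id_left e_def)
  have "presents C F A B f e"
    unfolding presents_def
  proof (intro conjI ballI AB f e)
    fix X u v assume a: "X \<in> Obj C" "u \<in> arr C X B" "v \<in> arr C X B"
    interpret g: group "Hom C X B" using a AB by (simp add: hom_group)
    have "\<pi> X (u \<otimes>\<^bsub>Hom C X B\<^esub> v) = \<pi> X u \<otimes>\<^bsub>FOb F X\<^esub> \<pi> X v"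
      using natural_hom[OF \<pi> a(1)] a by (simp add: hom_functor_def hom_def)
    then show "FMor F (u \<otimes>\<^bsub>Hom C X B\<^esub> v) e = FMor F u e \<otimes>\<^bsub>FOb F X\<^esub> FMor F v e"
      using a by (simp add: ye)
  next
    fix X x assume a: "X \<in> Obj C" "x \<in> carrier (FOb F X)"
    then obtain u where "u \<in> arr C X B" "x = \<pi> X u" using sur by blast
    then show "\<exists>u\<in>arr C X B. x = FMor F u e" using ye a by auto
  next
    fix X u assume a: "X \<in> Obj C" "u \<in> arr C X B"
    have "FMor F u e = \<one>\<^bsub>FOb F X\<^esub> \<longleftrightarrow> u \<in> \<alpha> X ` arr C X A"
      using a by (simp add: ker kernel_def ye)
    then show "FMor F u e = \<one>\<^bsub>FOb F X\<^esub> \<longleftrightarrow> (\<exists>w\<in>arr C X A. u = Comp C f w)"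
      using a by (auto simp: image_iff yf)
  qed
  then show "\<exists>A B f e. presents C F A B f e" by blast
next
  fix A B f e assume F: "is_functor C F" and p: "presents C F A B f e"
  note P = presentsD[OF p]
  define \<alpha> where "\<alpha> = (\<lambda>X\<in>Obj C. restrict (Comp C f) (carrier (FOb (hom_functor C A) X)))"
  define \<pi> where "\<pi> = (\<lambda>X\<in>Obj C. restrict (\<lambda>u. FMor F u e) (carrier (FOb (hom_functor C B) X)))"
  have "natural C (hom_functor C A) (hom_functor C B) (\<lambda>X. Comp C f)"
    using P(1-3) by (auto simp: natural_def hom_functor_def comp_hom_left comp_assoc)
  then have \<alpha>: "\<alpha> \<in> carrier (nat_group C (hom_functor C A) (hom_functor C B))"
    unfolding \<alpha>_def by (rule restrict_in_nat_group[OF hom_functor_is_functor[OF P(1)]])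
  have "natural C (hom_functor C B) F (\<lambda>X u. FMor F u e)"
    using P(2,4,5) functor_closed[OF F] functor_comp[OF F]
    by (auto simp: natural_def hom_functor_def hom_def)
  then have \<pi>: "\<pi> \<in> carrier (nat_group C (hom_functor C B) F)"
    unfolding \<pi>_def by (rule restrict_in_nat_group[OF hom_functor_is_functor[OF P(2)]])
  have "\<alpha> X ` arr C X A = kernel (Hom C X B) (FOb F X) (\<pi> X) \<and> \<pi> X ` arr C X B = carrier (FOb F X)"
    if X: "X \<in> Obj C" for X
  proof -
    have a: "\<alpha> X ` arr C X A = Comp C f ` arr C X A"
      and b: "\<pi> X ` arr C X B = (\<lambda>u. FMor F u e) ` arr C X B"
      and c: "\<And>u. u \<in> arr C X B \<Longrightarrow> \<pi> X u = FMor F u e"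
      using X by (auto simp: \<alpha>_def \<pi>_def hom_functor_def)
    show ?thesis unfolding a b
      using P(7)[OF X] P(6)[OF X] functor_closed[OF F X P(2) _ P(4)] comp_closed[OF X P(1,2) _ P(3)] c
      by (auto simp: kernel_def image_iff)
  qed
  then show "F \<in> fp C" unfolding fp_def using F \<alpha> \<pi> P(1,2) by blast
qed


lemma presents_hom:
  assumes F: "is_functor C F" and p: "presents C F A B f e" and X: "X \<in> Obj C"
  shows "(\<lambda>u. FMor F u e) \<in> hom (Hom C X B) (FOb F X)"
  using functor_closed[OF F X presentsD(2)[OF p] _ presentsD(4)[OF p]] presentsD(5)[OF p X]
  by (auto simp: hom_def)

text \<open>
  A finitely presented functor is additive: at the generator by presentation, and at every other
  element \<open>x = F k e\<close> by composing with \<open>k\<close>.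
\<close>

lemma presented_additive:
  assumes F: "is_functor C F" and p: "presents C F A B f e"
    and X: "X \<in> Obj C" and K: "K \<in> Obj C" and x: "x \<in> carrier (FOb F K)"
  shows "(\<lambda>u. FMor F u x) \<in> hom (Hom C X K) (FOb F X)"
proof -
  obtain k where k: "k \<in> arr C K B" "x = FMor F k e"
    using presentsD(6)[OF p K x] by blast
  interpret g: group "Hom C X K" by (rule hom_group[OF X K])
  have "FMor F u x = FMor F (Comp C k u) e" if "u \<in> arr C X K" for u
    using functor_comp[OF F X K presentsD(2)[OF p] that k(1) presentsD(4)[OF p]] k(2) by simp
  moreover have "(\<lambda>u. FMor F u e) \<circ> Comp C k \<in> hom (Hom C X K) (FOb F X)"
    by (rule hom_compose[OF comp_hom_left[OF X K presentsD(2)[OF p] k(1)] presents_hom[OF F p X]])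
  ultimately show ?thesis by (simp add: hom_def Pi_iff)
qed

end

section \<open>Subfunctors\<close>

definition subfunctor ::
  "('o, 'm, 'v) ab_functor \<Rightarrow> ('o \<Rightarrow> 'v set) \<Rightarrow> ('o, 'm, 'v) ab_functor" where
  "subfunctor F S = \<lparr>FOb = (\<lambda>X. (FOb F X)\<lparr>carrier := S X\<rparr>), FMor = FMor F\<rparr>"

definition stable_subgroups ::
  "('o, 'm) ab_cat \<Rightarrow> ('o, 'm, 'v) ab_functor \<Rightarrow> ('o \<Rightarrow> 'v set) \<Rightarrow> bool" where
  "stable_subgroups C F S \<longleftrightarrow> (\<forall>X\<in>Obj C. subgroup (S X) (FOb F X)) \<and>
     (\<forall>X\<in>Obj C. \<forall>Y\<in>Obj C. \<forall>f\<in>arr C X Y. \<forall>y\<in>S Y. FMor F f y \<in> S X)"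

lemma subfunctor_is_functor:
  assumes F: "is_functor C F" and S: "stable_subgroups C F S"
  shows "is_functor C (subfunctor F S)"
proof -
  have sub: "subgroup (S X) (FOb F X)" if "X \<in> Obj C" for X
    using S that by (simp add: stable_subgroups_def)
  have in_F: "x \<in> carrier (FOb F X)" if "X \<in> Obj C" "x \<in> S X" for X x
    using subgroup.mem_carrier[OF sub[OF that(1)] that(2)] .
  have "comm_group ((FOb F X)\<lparr>carrier := S X\<rparr>)" if "X \<in> Obj C" for X
  proof -
    interpret comm_group "FOb F X" by (rule functor_group[OF F that])
    show ?thesis
      by (rule group.group_comm_groupI[OF subgroup.subgroup_is_group[OF sub[OF that] is_group]])
        (use in_F[OF that] m_comm in auto)
  qed
  moreover have "FMor F f \<in> hom ((FOb F Y)\<lparr>carrier := S Y\<rparr>) ((FOb F X)\<lparr>carrier := S X\<rparr>)"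
    if "X \<in> Obj C" "Y \<in> Obj C" "f \<in> arr C X Y" for X Y f
    using functor_hom[OF F that] S that in_F by (auto simp: hom_def stable_subgroups_def)
  ultimately show ?thesis
    unfolding is_functor_def subfunctor_def
    using functor_id[OF F] functor_comp[OF F] in_F by auto
qed

text \<open>
  The subfunctor generated by the element \<open>x\<close> of \<open>F K\<close>, that is, the image of the transformation
  \<open>Hom(-,K) \<rightarrow> F\<close> that corresponds to \<open>x\<close>.
\<close>

definition generated ::
  "('o, 'm) ab_cat \<Rightarrow> ('o, 'm, 'v) ab_functor \<Rightarrow> 'o \<Rightarrow> 'v \<Rightarrow> 'o \<Rightarrow> 'v set" where
  "generated C F K x X = (\<lambda>u. FMor F u x) ` arr C X K"

context preadditive_category
begin

lemma generated_stable:
  assumes F: "is_functor C F" and p: "presents C F A B f e"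
    and K: "K \<in> Obj C" and x: "x \<in> carrier (FOb F K)"
  shows "stable_subgroups C F (generated C F K x)"
  unfolding stable_subgroups_def
proof (intro conjI ballI)
  fix X assume X: "X \<in> Obj C"
  interpret group_hom "Hom C X K" "FOb F X" "\<lambda>u. FMor F u x"
    using presented_additive[OF F p X K x] hom_group[OF X K] comm_group.axioms(2)[OF functor_group[OF F X]]
    by (simp add: group_hom_def group_hom_axioms_def)
  show "subgroup (generated C F K x X) (FOb F X)"
    unfolding generated_def by (rule img_is_subgroup)
next
  fix X Y f y assume a: "X \<in> Obj C" "Y \<in> Obj C" "f \<in> arr C X Y" "y \<in> generated C F K x Y"
  then obtain u where u: "u \<in> arr C Y K" "y = FMor F u x" by (auto simp: generated_def)
  have "FMor F f y = FMor F (Comp C u f) x"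
    using functor_comp[OF F a(1,2) K a(3) u(1) x] u(2) by simp
  then show "FMor F f y \<in> generated C F K x X"
    using comp_closed[OF a(1,2) K a(3) u(1)] by (auto simp: generated_def)
qed

lemma generated_self:
  assumes "is_functor C F" "K \<in> Obj C" "x \<in> carrier (FOb F K)"
  shows "x \<in> generated C F K x K"
  using functor_id[OF assms] id_closed[OF assms(2)] unfolding generated_def by (metis imageI)

text \<open>
  A subfunctor with one generator is finitely presented as soon as the morphisms that annihilate the
  generator are those that factor through one morphism \<open>g\<close>.
\<close>

lemma generated_presents:
  assumes F: "is_functor C F" and p: "presents C F A B f e"
    and A': "A' \<in> Obj C" and K: "K \<in> Obj C" and g: "g \<in> arr C A' K"
    and x: "x \<in> carrier (FOb F K)"
    and ann: "\<And>X u. X \<in> Obj C \<Longrightarrow> u \<in> arr C X K \<Longrightarrow>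
       FMor F u x = \<one>\<^bsub>FOb F X\<^esub> \<longleftrightarrow> (\<exists>w\<in>arr C X A'. u = Comp C g w)"
  shows "presents C (subfunctor F (generated C F K x)) A' K g x"
  unfolding presents_def
  using A' K g ann generated_self[OF F K x] presented_additive[OF F p _ K x]
  by (auto simp: subfunctor_def hom_def generated_def)

end

section \<open>Quotient functors on representatives\<close>

text \<open>
  The cosets of a subgroup of \<open>F X\<close> are sets, which do not belong to the type of the elements of
  \<open>F X\<close>. One chosen element of each coset takes the place of the coset; the quotient group then has
  a carrier in the original type.
\<close>

definition rep :: "('a, 'b) monoid_scheme \<Rightarrow> 'a set \<Rightarrow> 'a \<Rightarrow> 'a" where
  "rep G N x = (SOME y. y \<in> N #>\<^bsub>G\<^esub> x)"

definition rep_group :: "'a monoid \<Rightarrow> 'a set \<Rightarrow> 'a monoid" where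
  "rep_group G N =
    \<lparr>carrier = rep G N ` carrier G, mult = (\<lambda>x y. rep G N (x \<otimes>\<^bsub>G\<^esub> y)), one = rep G N \<one>\<^bsub>G\<^esub>\<rparr>"

lemma
  assumes G: "group G" and N: "subgroup N G" and x: "x \<in> carrier G"
  shows rep_coset: "N #>\<^bsub>G\<^esub> rep G N x = N #>\<^bsub>G\<^esub> x"
    and rep_closed: "rep G N x \<in> carrier G"
proof -
  interpret group G by (rule G)
  have "rep G N x \<in> N #>\<^bsub>G\<^esub> x"
    unfolding rep_def by (rule someI[of _ x]) (rule rcos_self[OF x N])
  then show "N #>\<^bsub>G\<^esub> rep G N x = N #>\<^bsub>G\<^esub> x" "rep G N x \<in> carrier G"
    using repr_independence[OF _ x N] subgroup.elemrcos_carrier[OF N G x] by auto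
qed

lemma rep_eq_iff_coset:
  assumes "group G" "subgroup N G" "x \<in> carrier G" "y \<in> carrier G"
  shows "rep G N x = rep G N y \<longleftrightarrow> N #>\<^bsub>G\<^esub> x = N #>\<^bsub>G\<^esub> y"
  using rep_coset[OF assms(1,2)] assms by (metis rep_def)

lemma rep_eq_iff:
  assumes G: "group G" and N: "subgroup N G" and x: "x \<in> carrier G" "y \<in> carrier G"
  shows "rep G N x = rep G N y \<longleftrightarrow> x \<otimes>\<^bsub>G\<^esub> inv\<^bsub>G\<^esub> y \<in> N"
proof -
  interpret group G by (rule G)
  have "N #>\<^bsub>G\<^esub> x = N #>\<^bsub>G\<^esub> y \<longleftrightarrow> x \<in> N #>\<^bsub>G\<^esub> y"
    using repr_independence[OF _ x(2) N] rcos_self[OF x(1) N] by auto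
  then show ?thesis
    using rep_eq_iff_coset[OF assms] subgroup.rcos_module[OF N G x(2,1)] by simp
qed

lemma rep_rep:
  assumes "group G" "subgroup N G" "x \<in> carrier G"
  shows "rep G N (rep G N x) = rep G N x"
  using rep_eq_iff_coset[OF assms(1,2) rep_closed[OF assms] assms(3)] rep_coset[OF assms] by simp

lemma rep_one_iff:
  assumes "group G" "subgroup N G" "x \<in> carrier G"
  shows "rep G N x = \<one>\<^bsub>rep_group G N\<^esub> \<longleftrightarrow> x \<in> N"
proof -
  interpret group G by fact
  show ?thesis using rep_eq_iff[OF assms one_closed] assms by (simp add: rep_group_def)
qed

lemma rep_hom:
  assumes G: "comm_group G" and N: "subgroup N G"
  shows "rep G N \<in> hom G (rep_group G N)"
proof -
  interpret comm_group G by (rule G)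
  interpret N: normal N G by (rule subgroup_imp_normal[OF N])
  have "rep G N (x \<otimes>\<^bsub>G\<^esub> y) = rep G N (rep G N x \<otimes>\<^bsub>G\<^esub> rep G N y)"
    if xy: "x \<in> carrier G" "y \<in> carrier G" for x y
  proof -
    have r: "rep G N x \<in> carrier G" "rep G N y \<in> carrier G"
      using rep_closed[OF is_group N] xy by auto
    have "N #>\<^bsub>G\<^esub> (rep G N x \<otimes>\<^bsub>G\<^esub> rep G N y) = N #>\<^bsub>G\<^esub> (x \<otimes>\<^bsub>G\<^esub> y)"
      using N.rcos_sum[OF r] N.rcos_sum[OF xy] rep_coset[OF is_group N] xy by simp
    then show ?thesis using rep_eq_iff_coset[OF is_group N] xy r by simp
  qed
  then show ?thesis by (auto simp: hom_def rep_group_def)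
qed

lemma rep_group_comm_group:
  assumes "comm_group G" "subgroup N G"
  shows "comm_group (rep_group G N)"
  using comm_group.hom_imp_img_comm_group[OF assms(1) rep_hom[OF assms]]
  by (simp add: rep_group_def)

text \<open>
  In a quotient functor a morphism \<open>f\<close> acts by first applying \<open>F f\<close> and then choosing a representative in the
  group at the source of \<open>f\<close>. Hom-sets are disjoint, so \<open>f\<close> determines its source.
\<close>

definition source :: "('o, 'm) ab_cat \<Rightarrow> 'm \<Rightarrow> 'o" where
  "source C f = (THE X. X \<in> Obj C \<and> (\<exists>Y\<in>Obj C. f \<in> arr C X Y))"

definition quotient_functor ::
  "('o, 'm) ab_cat \<Rightarrow> ('o, 'm, 'v) ab_functor \<Rightarrow> ('o \<Rightarrow> 'v set) \<Rightarrow> ('o, 'm, 'v) ab_functor" where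
  "quotient_functor C F N =
    \<lparr>FOb = (\<lambda>X. rep_group (FOb F X) (N X)),
     FMor = (\<lambda>f y. rep (FOb F (source C f)) (N (source C f)) (FMor F f y))\<rparr>"

context preadditive_category
begin

lemma source_eq: "X \<in> Obj C \<Longrightarrow> Y \<in> Obj C \<Longrightarrow> f \<in> arr C X Y \<Longrightarrow> source C f = X"
  unfolding source_def by (rule the_equality) (use hom_disjoint in blast)+

text \<open>
  Stability of \<open>N\<close> says that \<open>F f\<close> respects the cosets, so applying \<open>F f\<close> to a representative or to
  the element that it represents leads to the same coset. This is naturality of the projection \<open>rep\<close>,
  and the functor laws of the quotient follow from those of \<open>F\<close> along this surjection.
\<close>

lemma
  assumes F: "is_functor C F" and N: "stable_subgroups C F N"
  shows quotient_is_functor: "is_functor C (quotient_functor C F N)"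
    and rep_natural: "natural C F (quotient_functor C F N) (\<lambda>X. rep (FOb F X) (N X))"
proof -
  let ?Q = "quotient_functor C F N" and ?r = "\<lambda>X. rep (FOb F X) (N X)"
  have Fg: "group (FOb F X)" if "X \<in> Obj C" for X
    using comm_group.axioms(2)[OF functor_group[OF F that]] .
  have sub: "subgroup (N X) (FOb F X)" if "X \<in> Obj C" for X
    using N that by (simp add: stable_subgroups_def)
  have mor: "FMor ?Q f y = ?r X (FMor F f y)" if "X \<in> Obj C" "Y \<in> Obj C" "f \<in> arr C X Y" for X Y f y
    by (simp add: quotient_functor_def source_eq[OF that])
  have car: "carrier (FOb ?Q X) = ?r X ` carrier (FOb F X)" for X
    by (simp add: quotient_functor_def rep_group_def)
  have rhom: "?r X \<in> hom (FOb F X) (FOb ?Q X)" if "X \<in> Obj C" for X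
    using rep_hom[OF functor_group[OF F that] sub[OF that]] by (simp add: quotient_functor_def)
  have comm: "?r X (FMor F f y) = FMor ?Q f (?r Y y)"
    if a: "X \<in> Obj C" "Y \<in> Obj C" "f \<in> arr C X Y" "y \<in> carrier (FOb F Y)" for X Y f y
  proof -
    interpret Y: group "FOb F Y" by (rule Fg[OF a(2)])
    interpret f: group_hom "FOb F Y" "FOb F X" "FMor F f"
      using functor_hom[OF F a(1-3)] Fg[OF a(1)] Fg[OF a(2)]
      by (simp add: group_hom_def group_hom_axioms_def)
    have r: "?r Y y \<in> carrier (FOb F Y)" by (rule rep_closed[OF Fg[OF a(2)] sub[OF a(2)] a(4)])
    have "y \<otimes>\<^bsub>FOb F Y\<^esub> inv\<^bsub>FOb F Y\<^esub> (?r Y y) \<in> N Y"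
      using rep_eq_iff[OF Fg[OF a(2)] sub[OF a(2)] a(4) r] rep_rep[OF Fg[OF a(2)] sub[OF a(2)] a(4)]
      by simp
    then have "FMor F f (y \<otimes>\<^bsub>FOb F Y\<^esub> inv\<^bsub>FOb F Y\<^esub> (?r Y y)) \<in> N X"
      using N a(1-3) by (auto simp: stable_subgroups_def)
    then have "FMor F f y \<otimes>\<^bsub>FOb F X\<^esub> inv\<^bsub>FOb F X\<^esub> FMor F f (?r Y y) \<in> N X"
      using a(4) r by simp
    then have "?r X (FMor F f y) = ?r X (FMor F f (?r Y y))"
      using rep_eq_iff[OF Fg[OF a(1)] sub[OF a(1)]] a(4) r by simp
    then show ?thesis by (simp add: mor[OF a(1-3)])
  qed
  show nat: "natural C F ?Q ?r"
    unfolding natural_def using rhom comm by simp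
  show "is_functor C ?Q"
    unfolding is_functor_def
  proof (intro conjI ballI)
    fix X assume "X \<in> Obj C"
    then show "comm_group (FOb ?Q X)"
      using rep_group_comm_group[OF functor_group[OF F] sub] by (simp add: quotient_functor_def)
  next
    fix X Y f assume a: "X \<in> Obj C" "Y \<in> Obj C" "f \<in> arr C X Y"
    interpret Y: group "FOb F Y" by (rule Fg[OF a(2)])
    have "FMor ?Q f (?r Y x \<otimes>\<^bsub>FOb ?Q Y\<^esub> ?r Y y) = FMor ?Q f (?r Y x) \<otimes>\<^bsub>FOb ?Q X\<^esub> FMor ?Q f (?r Y y)"
      if xy: "x \<in> carrier (FOb F Y)" "y \<in> carrier (FOb F Y)" for x y
    proof -
      have "FMor ?Q f (?r Y x \<otimes>\<^bsub>FOb ?Q Y\<^esub> ?r Y y) = FMor ?Q f (?r Y (x \<otimes>\<^bsub>FOb F Y\<^esub> y))"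
        using hom_mult[OF rhom[OF a(2)] xy] by simp
      also have "\<dots> = ?r X (FMor F f x \<otimes>\<^bsub>FOb F X\<^esub> FMor F f y)"
        using comm[OF a, of "x \<otimes>\<^bsub>FOb F Y\<^esub> y"] xy hom_mult[OF functor_hom[OF F a] xy] by simp
      also have "\<dots> = FMor ?Q f (?r Y x) \<otimes>\<^bsub>FOb ?Q X\<^esub> FMor ?Q f (?r Y y)"
        using hom_mult[OF rhom[OF a(1)]] functor_closed[OF F a] xy comm[OF a] by simp
      finally show ?thesis .
    qed
    moreover have "FMor ?Q f (?r Y y) \<in> carrier (FOb ?Q X)" if "y \<in> carrier (FOb F Y)" for y
      using comm[OF a that] functor_closed[OF F a that] by (metis car imageI)
    ultimately show "FMor ?Q f \<in> hom (FOb ?Q Y) (FOb ?Q X)"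
      by (auto simp: hom_def car)
  next
    fix X x assume a: "X \<in> Obj C" "x \<in> carrier (FOb ?Q X)"
    then obtain y where y: "y \<in> carrier (FOb F X)" "x = ?r X y" by (auto simp: car)
    show "FMor ?Q (Id C X) x = x"
      using comm[OF a(1) a(1) id_closed[OF a(1)] y(1)] functor_id[OF F a(1) y(1)] y(2) by simp
  next
    fix X Y Z f g x
    assume a: "X \<in> Obj C" "Y \<in> Obj C" "Z \<in> Obj C" "f \<in> arr C X Y" "g \<in> arr C Y Z"
      "x \<in> carrier (FOb ?Q Z)"
    then obtain z where z: "z \<in> carrier (FOb F Z)" "x = ?r Z z" by (auto simp: car)
    show "FMor ?Q (Comp C g f) x = FMor ?Q f (FMor ?Q g x)"
      unfolding z(2)
      using comm[OF a(1,3) comp_closed[OF a(1-5)] z(1)] comm[OF a(2,3,5) z(1)]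
        comm[OF a(1,2,4) functor_closed[OF F a(2,3,5) z(1)]] functor_comp[OF F a(1-5) z(1)]
      by simp
  qed
qed


text \<open>
  Killing the subfunctor generated by \<open>F r e\<close> adds to the morphisms that annihilate the generator
  those that factor through \<open>r\<close>, so \<open>f\<close> is replaced by \<open>(f, r)\<close>.
\<close>

lemma quotient_presents:
  assumes F: "is_functor C F" and p: "presents C F A B f e"
    and K: "K \<in> Obj C" and r: "r \<in> arr C K B" and b: "biproduct C A K S i\<^sub>1 i\<^sub>2 p\<^sub>1 p\<^sub>2"
  defines "N \<equiv> generated C F K (FMor F r e)"
  shows "presents C (quotient_functor C F N) S B
    (Comp C f p\<^sub>1 \<otimes>\<^bsub>Hom C S B\<^esub> Comp C r p\<^sub>2) (rep (FOb F B) (N B) e)"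
proof -
  note P = presentsD[OF p]
  let ?Q = "quotient_functor C F N" and ?r = "\<lambda>X. rep (FOb F X) (N X)"
  have x: "FMor F r e \<in> carrier (FOb F K)" by (rule functor_closed[OF F K P(2) r P(4)])
  have N: "stable_subgroups C F N" unfolding N_def by (rule generated_stable[OF F p K x])
  have nat: "natural C F ?Q ?r" by (rule rep_natural[OF F N])
  have mor: "FMor ?Q u (?r B e) = ?r X (FMor F u e)" if "X \<in> Obj C" "u \<in> arr C X B" for X u
    using natural_comm[OF nat that(1) P(2) that(2) P(4)] by simp
  have S: "S \<in> Obj C" using b by (simp add: biproduct_def)
  show ?thesis
    unfolding presents_def
  proof (intro conjI ballI)
    show "S \<in> Obj C" "B \<in> Obj C" by (rule S, rule P(2))
    show "Comp C f p\<^sub>1 \<otimes>\<^bsub>Hom C S B\<^esub> Comp C r p\<^sub>2 \<in> arr C S B"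
      by (rule biproduct_copair(1)[OF P(1) K P(2) P(2) P(3) r b])
    show "?r B e \<in> carrier (FOb ?Q B)" by (rule natural_closed[OF nat P(2) P(4)])
  next
    fix X u v assume a: "X \<in> Obj C" "u \<in> arr C X B" "v \<in> arr C X B"
    interpret XB: group "Hom C X B" by (rule hom_group[OF a(1) P(2)])
    have "FMor F u e \<in> carrier (FOb F X)" "FMor F v e \<in> carrier (FOb F X)"
      using functor_closed[OF F a(1) P(2) _ P(4)] a(2,3) by auto
    then show "FMor ?Q (u \<otimes>\<^bsub>Hom C X B\<^esub> v) (?r B e) =
        FMor ?Q u (?r B e) \<otimes>\<^bsub>FOb ?Q X\<^esub> FMor ?Q v (?r B e)"
      using a P(5)[OF a] hom_mult[OF natural_hom[OF nat a(1)]] by (simp add: mor)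
  next
    fix X x assume a: "X \<in> Obj C" "x \<in> carrier (FOb ?Q X)"
    then obtain y where y: "y \<in> carrier (FOb F X)" "x = ?r X y"
      by (auto simp: quotient_functor_def rep_group_def)
    then show "\<exists>u\<in>arr C X B. x = FMor ?Q u (?r B e)"
      using P(6)[OF a(1) y(1)] mor[OF a(1)] by auto
  next
    fix X u assume a: "X \<in> Obj C" "u \<in> arr C X B"
    interpret XB: group "Hom C X B" by (rule hom_group[OF a(1) P(2)])
    have FX: "group (FOb F X)" using comm_group.axioms(2)[OF functor_group[OF F a(1)]] .
    have rb: "Comp C r w \<in> arr C X B" if "w \<in> arr C X K" for w
      by (rule comp_closed[OF a(1) K P(2) that r])
    have fa: "Comp C f w \<in> arr C X B" if "w \<in> arr C X A" for w
      by (rule comp_closed[OF a(1) P(1) P(2) that P(3)])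
    have "FMor ?Q u (?r B e) = \<one>\<^bsub>FOb ?Q X\<^esub> \<longleftrightarrow> FMor F u e \<in> N X"
      unfolding mor[OF a]
      using rep_one_iff[OF FX _ functor_closed[OF F a(1) P(2) a(2) P(4)]] N a
      by (simp add: stable_subgroups_def quotient_functor_def)
    also have "\<dots> \<longleftrightarrow> (\<exists>b\<in>arr C X K. FMor F u e = FMor F (Comp C r b) e)"
      using functor_comp[OF F a(1) K P(2) _ r P(4)] by (auto simp: N_def generated_def)
    \<comment> \<open>The difference of \<open>u\<close> and \<open>r b\<close> annihilates \<open>e\<close>, so it factors through \<open>f\<close>.\<close>
    also have "\<dots> \<longleftrightarrow> (\<exists>b\<in>arr C X K. \<exists>a\<in>arr C X A. u \<otimes>\<^bsub>Hom C X B\<^esub> inv\<^bsub>Hom C X B\<^esub> Comp C r b = Comp C f a)"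
      using hom_eq_iff[OF XB.is_group FX presents_hom[OF F p a(1)] a(2) rb] P(7)[OF a(1)] a(2) rb
      by simp
    also have "\<dots> \<longleftrightarrow> (\<exists>b\<in>arr C X K. \<exists>a\<in>arr C X A. u = Comp C f a \<otimes>\<^bsub>Hom C X B\<^esub> Comp C r b)"
      using a(2) rb fa by (simp add: XB.inv_solve_right')
    also have "\<dots> \<longleftrightarrow> (\<exists>w\<in>arr C X S. u = Comp C (Comp C f p\<^sub>1 \<otimes>\<^bsub>Hom C S B\<^esub> Comp C r p\<^sub>2) w)"
      using biproduct_copair(2)[OF P(1) K P(2) a(1) P(3) r b] by blast
    finally show "FMor ?Q u (?r B e) = \<one>\<^bsub>FOb ?Q X\<^esub> \<longleftrightarrow>
      (\<exists>w\<in>arr C X S. u = Comp C (Comp C f p\<^sub>1 \<otimes>\<^bsub>Hom C S B\<^esub> Comp C r p\<^sub>2) w)" .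
  qed
qed

section \<open>Orthogonality of \<open>P(-,A)\<close>\<close>

lemma fp0I:
  assumes G: "is_functor C G" and p: "presents C G A B f e"
    and z: "\<And>P x. projective C P \<Longrightarrow> x \<in> carrier (FOb G P) \<Longrightarrow> x = \<one>\<^bsub>FOb G P\<^esub>"
  shows "G \<in> fp0 C"
proof -
  have "trivial_group (FOb G P)" if P: "projective C P" for P
  proof -
    interpret comm_group "FOb G P"
      using functor_group[OF G] P by (simp add: projective_def)
    show ?thesis unfolding trivial_group_def using z[OF P] is_group one_closed by blast
  qed
  then show ?thesis using G p unfolding fp0_def fp_iff_presents by blast
qed

lemma fp0D:
  assumes "G \<in> fp0 C"
  shows "is_functor C G" "\<And>P x. projective C P \<Longrightarrow> x \<in> carrier (FOb G P) \<Longrightarrow> x = \<one>\<^bsub>FOb G P\<^esub>"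
  using assms by (auto simp: fp0_def fp_def trivial_group_def)

lemma proj_hom_closed:
  "X \<in> Obj C \<Longrightarrow> A \<in> Obj C \<Longrightarrow> projective C P \<Longrightarrow> g \<in> arr C X P \<Longrightarrow> h \<in> arr C P A
    \<Longrightarrow> Comp C h g \<in> proj_factoring C X A"
  unfolding proj_factoring_def projective_def using comp_closed by blast

text \<open>
  Restriction along an epimorphism from a projective is injective on \<open>F\<close>, because \<open>F\<close> embeds in
  \<open>Hom(-,A)\<close>; by naturality it kills whatever comes from \<open>G X\<close>, which restricts to zero.
\<close>

lemma proj_functor_receives_zero:
  assumes enough: "enough_projectives C" and F: "is_functor C F" and A: "A \<in> Obj C"
    and iso: "nat_iso C F (proj_functor C A)" and G: "G \<in> fp0 C"
  shows "trivial_group (nat_group C G F)"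
  unfolding trivial_nat_group_iff[OF fp0D(1)[OF G] F]
proof (intro allI impI ballI)
  fix \<eta> X x assume \<eta>: "natural C G F \<eta>" and X: "X \<in> Obj C" and x: "x \<in> carrier (FOb G X)"
  obtain h where h: "natural C F (proj_functor C A) h"
    and bij: "\<And>X. X \<in> Obj C \<Longrightarrow> bij_betw (h X) (carrier (FOb F X)) (carrier (FOb (proj_functor C A) X))"
    using iso unfolding nat_iso_iff[OF F] by blast
  obtain P c where P: "projective C P" "P \<in> Obj C" and c: "epic C P X c" "c \<in> arr C P X"
    using enough X unfolding enough_projectives_def projective_def epic_def by blast
  interpret FX: comm_group "FOb F X" by (rule functor_group[OF F X])
  have "FMor F c (\<eta> X x) = \<eta> P (FMor G c x)"
    by (rule natural_comm[OF \<eta> P(2) X c(2) x, symmetric])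
  also have "FMor G c x = \<one>\<^bsub>FOb G P\<^esub>"
    by (rule fp0D(2)[OF G P(1) functor_closed[OF fp0D(1)[OF G] P(2) X c(2) x]])
  also have "\<eta> P \<one>\<^bsub>FOb G P\<^esub> = \<one>\<^bsub>FOb F P\<^esub>" by (rule natural_one[OF fp0D(1)[OF G] F \<eta> P(2)])
  also have "\<dots> = FMor F c \<one>\<^bsub>FOb F X\<^esub>" by (rule functor_one[OF F P(2) X c(2), symmetric])
  finally have eq: "FMor F c (\<eta> X x) = FMor F c \<one>\<^bsub>FOb F X\<^esub>" .
  have y: "\<eta> X x \<in> carrier (FOb F X)" by (rule natural_closed[OF \<eta> X x])
  have "Comp C (h X (\<eta> X x)) c = Comp C (h X \<one>\<^bsub>FOb F X\<^esub>) c"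
    using natural_comm[OF h P(2) X c(2) y] natural_comm[OF h P(2) X c(2) FX.one_closed] eq
    by (simp add: proj_functor_def)
  moreover have "h X (\<eta> X x) \<in> arr C X A" "h X \<one>\<^bsub>FOb F X\<^esub> \<in> arr C X A"
    using natural_closed[OF h X y] natural_closed[OF h X FX.one_closed]
    by (simp_all add: proj_functor_def proj_factoring_def)
  ultimately have "h X (\<eta> X x) = h X \<one>\<^bsub>FOb F X\<^esub>"
    using c(1) A unfolding epic_def by blast
  then show "\<eta> X x = \<one>\<^bsub>FOb F X\<^esub>"
    using bij[OF X] y FX.one_closed by (meson bij_betw_imp_inj_on inj_onD)
qed

text \<open>
  A factorization \<open>b \<circ> a\<close> through a projective \<open>P\<close> exhibits an element of \<open>P(X,A)\<close> as the restriction
  along \<open>a\<close> of the element \<open>b\<close> of \<open>P(P,A)\<close>, and \<open>b\<close> has to go to \<open>G P = 0\<close>.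
\<close>

lemma proj_functor_emits_zero:
  assumes F: "is_functor C F" and A: "A \<in> Obj C"
    and iso: "nat_iso C F (proj_functor C A)" and G: "G \<in> fp0 C"
  shows "trivial_group (nat_group C F G)"
  unfolding trivial_nat_group_iff[OF F fp0D(1)[OF G]]
proof (intro allI impI ballI)
  fix \<eta> X x assume \<eta>: "natural C F G \<eta>" and X: "X \<in> Obj C" and x: "x \<in> carrier (FOb F X)"
  obtain h where h: "natural C F (proj_functor C A) h"
    and bij: "\<And>X. X \<in> Obj C \<Longrightarrow> bij_betw (h X) (carrier (FOb F X)) (carrier (FOb (proj_functor C A) X))"
    using iso unfolding nat_iso_iff[OF F] by blast
  have "h X x \<in> proj_factoring C X A"
    using natural_closed[OF h X x] by (simp add: proj_functor_def)
  then obtain P a b where P: "projective C P" "P \<in> Obj C" and a: "a \<in> arr C X P" and b: "b \<in> arr C P A"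
    and hx: "h X x = Comp C b a"
    by (auto simp: proj_factoring_def projective_def)
  \<comment> \<open>\<open>b\<close> factors through the projective \<open>P\<close> as \<open>b \<circ> 1\<close>.\<close>
  have "b \<in> proj_factoring C P A"
    using proj_hom_closed[OF P(2) A P(1) id_closed[OF P(2)] b] id_right[OF P(2) A b] by simp
  then have "b \<in> h P ` carrier (FOb F P)"
    using bij[OF P(2)] by (simp add: bij_betw_def proj_functor_def)
  then obtain y where y: "y \<in> carrier (FOb F P)" "h P y = b" by blast
  have "h X (FMor F a y) = h X x"
    using natural_comm[OF h X P(2) a y(1)] y(2) hx by (simp add: proj_functor_def)
  then have "FMor F a y = x"
    using bij[OF X] x functor_closed[OF F X P(2) a y(1)] by (meson bij_betw_imp_inj_on inj_onD)
  then have "\<eta> X x = FMor G a (\<eta> P y)" using natural_comm[OF \<eta> X P(2) a y(1)] by simp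
  also have "\<dots> = FMor G a \<one>\<^bsub>FOb G P\<^esub>"
    using fp0D(2)[OF G P(1) natural_closed[OF \<eta> P(2) y(1)]] by simp
  also have "\<dots> = \<one>\<^bsub>FOb G X\<^esub>" by (rule functor_one[OF fp0D(1)[OF G] X P(2) a])
  finally show "\<eta> X x = \<one>\<^bsub>FOb G X\<^esub>" .
qed

end

section \<open>Orthogonal functors are of the form \<open>P(-,A)\<close>\<close>

context abelian_category
begin

text \<open>
  The image of \<open>f\<close> is the kernel \<open>i\<close> of its cokernel. To see that the induced \<open>f'\<close> is epic, suppose
  \<open>z f' = 0\<close> and let \<open>m\<close> be the kernel of \<open>z\<close>; then \<open>f\<close> factors through the monomorphism \<open>i m\<close>. That
  monomorphism is the kernel of some \<open>h\<close>, which kills \<open>f\<close> and therefore factors through the cokernel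
  of \<open>f\<close>. So \<open>h\<close> kills \<open>i\<close>, hence \<open>i\<close> factors through \<open>i m\<close>, which makes \<open>m\<close> split epic, and \<open>z m = 0\<close>
  gives \<open>z = 0\<close>.
\<close>

lemma epi_mono_factorization:
  assumes A: "A \<in> Obj C" and B: "B \<in> Obj C" and f: "f \<in> arr C A B"
    and q: "is_cokernel C A B f Q q" and i: "is_kernel C B Q q I i"
  obtains f' where "epic C A I f'" "f = Comp C i f'"
proof -
  have Q: "Q \<in> Obj C" "q \<in> arr C B Q" "Comp C q f = \<one>\<^bsub>Hom C A Q\<^esub>"
    and Quniv: "\<And>Z u. Z \<in> Obj C \<Longrightarrow> u \<in> arr C B Z \<Longrightarrow> Comp C u f = \<one>\<^bsub>Hom C A Z\<^esub> \<Longrightarrow>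
      \<exists>v. v \<in> arr C Q Z \<and> Comp C v q = u"
    using q unfolding is_cokernel_def by blast+
  have I: "I \<in> Obj C" "i \<in> arr C I B" "Comp C q i = \<one>\<^bsub>Hom C I Q\<^esub>"
    using i unfolding is_kernel_def by blast+
  obtain f' where f': "f' \<in> arr C A I" "f = Comp C i f'"
    using i A f Q unfolding is_kernel_def by metis
  have "epic C A I f'"
  proof (rule epicI_zero[OF A I(1) f'(1)])
    fix Z z assume Z: "Z \<in> Obj C" and z: "z \<in> arr C I Z" and zf: "Comp C z f' = \<one>\<^bsub>Hom C A Z\<^esub>"
    obtain K m where m: "is_kernel C I Z z K m" using kernel_exists[OF I(1) Z z] by blast
    then have K: "K \<in> Obj C" "m \<in> arr C K I" "Comp C z m = \<one>\<^bsub>Hom C K Z\<^esub>"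
      unfolding is_kernel_def by blast+
    obtain g where g: "g \<in> arr C A K" "f' = Comp C m g"
      using m A f' zf unfolding is_kernel_def by metis
    have im: "Comp C i m \<in> arr C K B" by (rule comp_closed[OF K(1) I(1) B K(2) I(2)])
    have "monic C K B (Comp C i m)"
      unfolding monic_def
    proof (intro conjI ballI impI im)
      fix W u v assume W: "W \<in> Obj C" and u: "u \<in> arr C W K" and v: "v \<in> arr C W K"
        and eq: "Comp C (Comp C i m) u = Comp C (Comp C i m) v"
      have "Comp C i (Comp C m u) = Comp C i (Comp C m v)"
        using eq comp_assoc[OF W K(1) I(1) B u K(2) I(2)] comp_assoc[OF W K(1) I(1) B v K(2) I(2)]
        by simp
      then have "Comp C m u = Comp C m v"
        by (rule kernel_cancel[OF B Q(1,2) i W comp_closed[OF W K(1) I(1) u K(2)]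
              comp_closed[OF W K(1) I(1) v K(2)]])
      then show "u = v" by (rule kernel_cancel[OF I(1) Z z m W u v])
    qed
    from monic_normal[OF K(1) B this] obtain D h where D: "D \<in> Obj C" and h: "h \<in> arr C B D"
      and ker: "is_kernel C B D h K (Comp C i m)" by blast
    have him: "Comp C h (Comp C i m) = \<one>\<^bsub>Hom C K D\<^esub>" using ker by (simp add: is_kernel_def)
    have "Comp C h f = Comp C (Comp C h (Comp C i m)) g"
      using comp_assoc[OF A K(1) I(1) B g(1) K(2) I(2)] comp_assoc[OF A K(1) B D g(1) im h]
      by (simp add: f'(2) g(2))
    then have "Comp C h f = \<one>\<^bsub>Hom C A D\<^esub>" by (simp add: him zero_comp[OF A K(1) D g(1)])
    then obtain h' where h': "h' \<in> arr C Q D" "h = Comp C h' q" using Quniv[OF D h] by metis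
    have "Comp C h i = \<one>\<^bsub>Hom C I D\<^esub>"
      using comp_assoc[OF I(1) B Q(1) D I(2) Q(2) h'(1)]
      by (simp add: h'(2) I(3) comp_zero[OF I(1) Q(1) D h'(1)])
    then obtain s where s: "s \<in> arr C I K" "Comp C (Comp C i m) s = i"
      using ker I(1,2) unfolding is_kernel_def by metis
    have "Comp C i (Comp C m s) = Comp C i (Id C I)"
      using s(2) comp_assoc[OF I(1) K(1) I(1) B s(1) K(2) I(2)] id_right[OF I(1) B I(2)] by simp
    then have "Comp C m s = Id C I"
      by (rule kernel_cancel[OF B Q(1,2) i I(1) comp_closed[OF I(1) K(1) I(1) s(1) K(2)]
            id_closed[OF I(1)]])
    then have "z = Comp C (Comp C z m) s"
      using comp_assoc[OF I(1) K(1) I(1) Z s(1) K(2) z] id_right[OF I(1) Z z] by simp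
    then show "z = \<one>\<^bsub>Hom C I Z\<^esub>" by (simp add: K(3) zero_comp[OF I(1) K(1) Z s(1)])
  qed
  with f'(2) show thesis by (rule that[rotated])
qed

text \<open>
  A morphism killed by \<open>q\<close> factors through the image \<open>i\<close> of \<open>f\<close>. The subfunctor generated by \<open>F i e\<close>
  measures the difference between the morphisms into \<open>B\<close> that factor through \<open>i\<close> and those that factor
  through \<open>f\<close>. It is presented by the epimorphism \<open>f'\<close> onto the image, so it vanishes on projectives,
  and orthogonality applied to its inclusion into \<open>F\<close> shows that it is zero.
\<close>

lemma annihilator_of_generator:
  fixes F :: "('a, 'b, 'v) ab_functor"
  assumes F: "is_functor C F" and p: "presents C F A B f e" and q: "is_cokernel C A B f Q q"
    and orth: "\<And>G :: ('a, 'b, 'v) ab_functor. G \<in> fp0 C \<Longrightarrow> trivial_group (nat_group C G F)"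
    and X: "X \<in> Obj C" and v: "v \<in> arr C X B"
  shows "FMor F v e = \<one>\<^bsub>FOb F X\<^esub> \<longleftrightarrow> Comp C q v = \<one>\<^bsub>Hom C X Q\<^esub>"
proof
  note P = presentsD[OF p]
  have Q: "Q \<in> Obj C" "q \<in> arr C B Q" "Comp C q f = \<one>\<^bsub>Hom C A Q\<^esub>"
    using q unfolding is_cokernel_def by blast+
  {
    assume "FMor F v e = \<one>\<^bsub>FOb F X\<^esub>"
    then obtain w where w: "w \<in> arr C X A" "v = Comp C f w" using P(7)[OF X v] by blast
    show "Comp C q v = \<one>\<^bsub>Hom C X Q\<^esub>"
      by (simp add: w(2) comp_assoc[OF X P(1,2) Q(1) w(1) P(3) Q(2)] Q(3) zero_comp[OF X P(1) Q(1) w(1)])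
  next
    assume qv: "Comp C q v = \<one>\<^bsub>Hom C X Q\<^esub>"
    obtain I i where i: "is_kernel C B Q q I i" using kernel_exists[OF P(2) Q(1,2)] by blast
    obtain f' where f': "epic C A I f'" "f = Comp C i f'"
      by (rule epi_mono_factorization[OF P(1-3) q i])
    have I: "I \<in> Obj C" "i \<in> arr C I B" using i unfolding is_kernel_def by blast+
    have f'a: "f' \<in> arr C A I" using f'(1) by (simp add: epic_def)
    let ?x = "FMor F i e"
    have x: "?x \<in> carrier (FOb F I)" by (rule functor_closed[OF F I(1) P(2) I(2) P(4)])
    let ?S = "generated C F I ?x"
    have S: "stable_subgroups C F ?S" by (rule generated_stable[OF F p I(1) x])
    have G: "is_functor C (subfunctor F ?S)" by (rule subfunctor_is_functor[OF F S])
    have act: "FMor F u ?x = FMor F (Comp C i u) e" if "Y \<in> Obj C" "u \<in> arr C Y I" for Y u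
      using functor_comp[OF F that(1) I(1) P(2) that(2) I(2) P(4)] by simp
    have ann: "FMor F u ?x = \<one>\<^bsub>FOb F Y\<^esub> \<longleftrightarrow> (\<exists>w\<in>arr C Y A. u = Comp C f' w)"
      if Y: "Y \<in> Obj C" and u: "u \<in> arr C Y I" for Y u
    proof -
      have "FMor F u ?x = \<one>\<^bsub>FOb F Y\<^esub> \<longleftrightarrow> (\<exists>w\<in>arr C Y A. Comp C i u = Comp C f w)"
        using P(7)[OF Y comp_closed[OF Y I(1) P(2) u I(2)]] act[OF Y u] by simp
      also have "\<dots> \<longleftrightarrow> (\<exists>w\<in>arr C Y A. Comp C i u = Comp C i (Comp C f' w))"
        using comp_assoc[OF Y P(1) I(1) P(2) _ f'a I(2)] f'(2) by simp
      also have "\<dots> \<longleftrightarrow> (\<exists>w\<in>arr C Y A. u = Comp C f' w)"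
        using kernel_cancel[OF P(2) Q(1,2) i Y u] comp_closed[OF Y P(1) I(1) _ f'a] by metis
      finally show ?thesis .
    qed
    have "subfunctor F ?S \<in> fp0 C"
    proof (rule fp0I[OF G generated_presents[OF F p P(1) I(1) f'a x ann]])
      fix R y assume R: "projective C R" and "y \<in> carrier (FOb (subfunctor F ?S) R)"
      then obtain u where u: "u \<in> arr C R I" "y = FMor F u ?x"
        by (auto simp: subfunctor_def generated_def)
      have R': "R \<in> Obj C" using R by (simp add: projective_def)
      have "\<exists>w\<in>arr C R A. Comp C f' w = u"
        using R f'(1) u(1) P(1) I(1) unfolding projective_def by blast
      then have "y = \<one>\<^bsub>FOb F R\<^esub>" using ann[OF R' u(1)] u(2) by blast
      then show "y = \<one>\<^bsub>FOb (subfunctor F ?S) R\<^esub>" by (simp add: subfunctor_def)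
    qed
    then have triv: "trivial_group (nat_group C (subfunctor F ?S) F)" by (rule orth)
    \<comment> \<open>The inclusion is the transformation that orthogonality forces to vanish.\<close>
    have "natural C (subfunctor F ?S) F (\<lambda>X x. x)"
      using S unfolding natural_def
      by (auto simp: subfunctor_def hom_def stable_subgroups_def dest: subgroup.mem_carrier)
    then have zero: "y = \<one>\<^bsub>FOb F X\<^esub>" if "y \<in> ?S X" for y
      using triv that X unfolding trivial_nat_group_iff[OF G F] by (auto simp: subfunctor_def)
    obtain u where u: "u \<in> arr C X I" "Comp C i u = v"
      using i X v qv unfolding is_kernel_def by metis
    have "FMor F v e \<in> ?S X"
      using act[OF X u(1)] u(2) imageI[OF u(1), of "\<lambda>u. FMor F u ?x"] by (simp add: generated_def)
    then show "FMor F v e = \<one>\<^bsub>FOb F X\<^esub>" by (rule zero)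
  }
qed

text \<open>
  The quotient of \<open>F\<close> by the subfunctor generated by \<open>F r e\<close> vanishes on a projective \<open>R\<close>: for
  \<open>v : R \<rightarrow> B\<close> the composite \<open>q v\<close> lifts along the epimorphism \<open>q r\<close>, so \<open>v\<close> and some \<open>r w\<close> agree after
  \<open>q\<close>, which by the hypothesis on annihilators means that \<open>F v e\<close> is the element \<open>F w (F r e)\<close> of the
  subfunctor. By orthogonality the projection from \<open>F\<close> to the quotient is zero.
\<close>

lemma generated_by_projective:
  fixes F :: "('a, 'b, 'v) ab_functor"
  assumes F: "is_functor C F" and p: "presents C F A B f e"
    and Q: "Q \<in> Obj C" "q \<in> arr C B Q"
    and ann: "\<And>X v. X \<in> Obj C \<Longrightarrow> v \<in> arr C X B \<Longrightarrow>
      FMor F v e = \<one>\<^bsub>FOb F X\<^esub> \<longleftrightarrow> Comp C q v = \<one>\<^bsub>Hom C X Q\<^esub>"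
    and orth: "\<And>G :: ('a, 'b, 'v) ab_functor. G \<in> fp0 C \<Longrightarrow> trivial_group (nat_group C F G)"
    and P: "P \<in> Obj C" and r: "r \<in> arr C P B" and c: "epic C P Q (Comp C q r)"
    and X: "X \<in> Obj C" and x: "x \<in> carrier (FOb F X)"
  shows "x \<in> generated C F P (FMor F r e) X"
proof -
  note D = presentsD[OF p]
  let ?N = "generated C F P (FMor F r e)"
  let ?Q = "quotient_functor C F ?N" and ?r = "\<lambda>X. rep (FOb F X) (?N X)"
  have re: "FMor F r e \<in> carrier (FOb F P)" by (rule functor_closed[OF F P D(2) r D(4)])
  have N: "stable_subgroups C F ?N" by (rule generated_stable[OF F p P re])
  have QF: "is_functor C ?Q" by (rule quotient_is_functor[OF F N])
  have nat: "natural C F ?Q ?r" by (rule rep_natural[OF F N])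
  have group: "group (FOb F Y)" if "Y \<in> Obj C" for Y
    using comm_group.axioms(2)[OF functor_group[OF F that]] .
  have one_iff: "?r Y y = \<one>\<^bsub>FOb ?Q Y\<^esub> \<longleftrightarrow> y \<in> ?N Y" if "Y \<in> Obj C" "y \<in> carrier (FOb F Y)" for Y y
    using rep_one_iff[OF group[OF that(1)] _ that(2)] N that(1)
    by (simp add: stable_subgroups_def quotient_functor_def)
  obtain S i\<^sub>1 i\<^sub>2 p\<^sub>1 p\<^sub>2 where b: "biproduct C A P S i\<^sub>1 i\<^sub>2 p\<^sub>1 p\<^sub>2"
    using biproduct_exists[OF D(1) P] by blast
  have "?Q \<in> fp0 C"
  proof (rule fp0I[OF QF quotient_presents[OF F p P r b]])
    fix R y assume R: "projective C R" and "y \<in> carrier (FOb ?Q R)"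
    then obtain z where z: "z \<in> carrier (FOb F R)" "y = ?r R z"
      by (auto simp: quotient_functor_def rep_group_def)
    have R': "R \<in> Obj C" using R by (simp add: projective_def)
    interpret RB: group "Hom C R B" by (rule hom_group[OF R' D(2)])
    interpret RQ: group "Hom C R Q" by (rule hom_group[OF R' Q(1)])
    obtain v where v: "v \<in> arr C R B" "z = FMor F v e" using D(6)[OF R' z(1)] by blast
    have qv: "Comp C q v \<in> arr C R Q" by (rule comp_closed[OF R' D(2) Q(1) v(1) Q(2)])
    have "\<exists>w\<in>arr C R P. Comp C (Comp C q r) w = Comp C q v"
      using R c qv P Q(1) unfolding projective_def by blast
    then obtain w where w: "w \<in> arr C R P" "Comp C (Comp C q r) w = Comp C q v" by blast
    have rw: "Comp C r w \<in> arr C R B" by (rule comp_closed[OF R' P D(2) w(1) r])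
    have "Comp C q v = Comp C q (Comp C r w)"
      using w(2) comp_assoc[OF R' P D(2) Q(1) w(1) r Q(2)] by simp
    then have "Comp C q (v \<otimes>\<^bsub>Hom C R B\<^esub> inv\<^bsub>Hom C R B\<^esub> Comp C r w) = \<one>\<^bsub>Hom C R Q\<^esub>"
      using hom_eq_iff[OF RB.is_group RQ.is_group comp_hom_left[OF R' D(2) Q] v(1) rw] by simp
    then have "FMor F v e = FMor F (Comp C r w) e"
      using hom_eq_iff[OF RB.is_group group[OF R'] presents_hom[OF F p R'] v(1) rw]
        ann[OF R', of "v \<otimes>\<^bsub>Hom C R B\<^esub> inv\<^bsub>Hom C R B\<^esub> Comp C r w"] v(1) rw by simp
    also have "\<dots> = FMor F w (FMor F r e)" by (rule functor_comp[OF F R' P D(2) w(1) r D(4)])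
    finally have "z \<in> ?N R" using v(2) w(1) by (simp add: generated_def)
    then show "y = \<one>\<^bsub>FOb ?Q R\<^esub>" using one_iff[OF R' z(1)] z(2) by simp
  qed
  then have "trivial_group (nat_group C F ?Q)" by (rule orth)
  then have "?r X x = \<one>\<^bsub>FOb ?Q X\<^esub>"
    using nat X x unfolding trivial_nat_group_iff[OF F QF] by blast
  then show ?thesis using one_iff[OF X x] by simp
qed

text \<open>
  The isomorphism sends \<open>F v e\<close> to \<open>q v\<close>. It is well defined and injective because \<open>q\<close> detects the
  annihilator of \<open>e\<close>. Its values factor through the projective \<open>P\<close> because \<open>F r e\<close> generates \<open>F\<close>, and it
  is onto because morphisms from a projective to \<open>Q\<close> lift along the epimorphism \<open>q\<close>.
\<close>

lemma orthogonal_imp_proj_functor: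
  fixes F :: "('a, 'b, 'v) ab_functor"
  assumes enough: "enough_projectives C" and F: "F \<in> fp C"
    and orth_left: "\<And>G :: ('a, 'b, 'v) ab_functor. G \<in> fp0 C \<Longrightarrow> trivial_group (nat_group C G F)"
    and orth_right: "\<And>G :: ('a, 'b, 'v) ab_functor. G \<in> fp0 C \<Longrightarrow> trivial_group (nat_group C F G)"
  shows "\<exists>Q\<in>Obj C. nat_iso C F (proj_functor C Q)"
proof -
  from F have Ff: "is_functor C F" and "\<exists>A B f e. presents C F A B f e"
    by (auto simp: fp_iff_presents)
  then obtain A B f e where p: "presents C F A B f e" by blast
  note D = presentsD[OF p]
  obtain Q q where q: "is_cokernel C A B f Q q" using cokernel_exists[OF D(1-3)] by blast
  then have Q: "Q \<in> Obj C" "q \<in> arr C B Q" unfolding is_cokernel_def by blast+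
  have qe: "epic C B Q q" by (rule cokernel_epic[OF D(1-3) q])
  have ann: "FMor F v e = \<one>\<^bsub>FOb F X\<^esub> \<longleftrightarrow> Comp C q v = \<one>\<^bsub>Hom C X Q\<^esub>"
    if "X \<in> Obj C" "v \<in> arr C X B" for X v
    by (rule annihilator_of_generator[OF Ff p q _ that]) (rule orth_left)
  have eq_iff: "FMor F u e = FMor F v e \<longleftrightarrow> Comp C q u = Comp C q v"
    if X: "X \<in> Obj C" and u: "u \<in> arr C X B" and v: "v \<in> arr C X B" for X u v
  proof -
    interpret XB: group "Hom C X B" by (rule hom_group[OF X D(2)])
    have g: "group (FOb F X)" using comm_group.axioms(2)[OF functor_group[OF Ff X]] .
    show ?thesis
      using hom_eq_iff[OF XB.is_group g presents_hom[OF Ff p X] u v]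
        hom_eq_iff[OF XB.is_group hom_group[OF X Q(1)] comp_hom_left[OF X D(2) Q] u v]
        ann[OF X, of "u \<otimes>\<^bsub>Hom C X B\<^esub> inv\<^bsub>Hom C X B\<^esub> v"] u v by simp
  qed
  obtain P c where P: "projective C P" "P \<in> Obj C" and c: "epic C P Q c" "c \<in> arr C P Q"
    using enough Q(1) unfolding enough_projectives_def projective_def epic_def by blast
  have "\<exists>r\<in>arr C P B. Comp C q r = c" using P(1) qe c(2) D(2) Q(1) unfolding projective_def by blast
  then obtain r where r: "r \<in> arr C P B" "Comp C q r = c" by blast
  have gen: "\<exists>w\<in>arr C X P. x = FMor F (Comp C r w) e"
    if X: "X \<in> Obj C" and x: "x \<in> carrier (FOb F X)" for X x
  proof -
    have "x \<in> generated C F P (FMor F r e) X"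
      by (rule generated_by_projective[OF Ff p Q _ _ P(2) r(1) _ X x])
        (use ann orth_right c(1) r(2) in simp_all)
    then show ?thesis
      using functor_comp[OF Ff X P(2) D(2) _ r(1) D(4)] by (auto simp: generated_def)
  qed
  \<comment> \<open>By \<open>eq_iff\<close> the value of \<open>h\<close> is the same for every \<open>v\<close> that represents \<open>x\<close>.\<close>
  define h where "h X x = Comp C q (SOME v. v \<in> arr C X B \<and> x = FMor F v e)" for X x
  have h: "h X (FMor F v e) = Comp C q v" if X: "X \<in> Obj C" and v: "v \<in> arr C X B" for X v
  proof -
    let ?v = "SOME u. u \<in> arr C X B \<and> FMor F v e = FMor F u e"
    have "?v \<in> arr C X B \<and> FMor F v e = FMor F ?v e" by (rule someI[of _ v]) (simp add: v)
    then show ?thesis using eq_iff[OF X v, of ?v] by (simp add: h_def)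
  qed
  have car: "Comp C q v \<in> proj_factoring C X Q" if X: "X \<in> Obj C" and v: "v \<in> arr C X B" for X v
  proof -
    obtain w where w: "w \<in> arr C X P" "FMor F v e = FMor F (Comp C r w) e"
      using gen[OF X functor_closed[OF Ff X D(2) v D(4)]] by blast
    have "Comp C q v = Comp C q (Comp C r w)"
      using eq_iff[OF X v comp_closed[OF X P(2) D(2) w(1) r(1)]] w(2) by simp
    also have "\<dots> = Comp C c w"
      using comp_assoc[OF X P(2) D(2) Q(1) w(1) r(1) Q(2)] r(2) by simp
    finally show ?thesis using proj_hom_closed[OF X Q(1) P(1) w(1) c(2)] by simp
  qed
  have "natural C F (proj_functor C Q) h"
    unfolding natural_def
  proof (intro conjI ballI)
    fix X assume X: "X \<in> Obj C"
    interpret XB: group "Hom C X B" by (rule hom_group[OF X D(2)])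
    show "h X \<in> hom (FOb F X) (FOb (proj_functor C Q) X)"
    proof (rule homI)
      fix x assume "x \<in> carrier (FOb F X)"
      then obtain u where u: "u \<in> arr C X B" "x = FMor F u e" using D(6)[OF X] by blast
      show "h X x \<in> carrier (FOb (proj_functor C Q) X)"
        using car[OF X u(1)] h[OF X u(1)] u(2) by (simp add: proj_functor_def)
      fix y assume "y \<in> carrier (FOb F X)"
      then obtain v where v: "v \<in> arr C X B" "y = FMor F v e" using D(6)[OF X] by blast
      have "h X (x \<otimes>\<^bsub>FOb F X\<^esub> y) = Comp C q (u \<otimes>\<^bsub>Hom C X B\<^esub> v)"
        using h[OF X, of "u \<otimes>\<^bsub>Hom C X B\<^esub> v"] D(5)[OF X u(1) v(1)] u v by simp
      then show "h X (x \<otimes>\<^bsub>FOb F X\<^esub> y) = h X x \<otimes>\<^bsub>FOb (proj_functor C Q) X\<^esub> h X y"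
        using comp_add_right[OF X D(2) Q(1) u(1) v(1) Q(2)] h[OF X u(1)] h[OF X v(1)] u(2) v(2)
        by (simp add: proj_functor_def)
    qed
  next
    fix X Y g y assume X: "X \<in> Obj C" and Y: "Y \<in> Obj C" and g: "g \<in> arr C X Y"
      and "y \<in> carrier (FOb F Y)"
    then obtain v where v: "v \<in> arr C Y B" "y = FMor F v e" using D(6)[OF Y] by blast
    have "FMor F g y = FMor F (Comp C v g) e"
      using functor_comp[OF Ff X Y D(2) g v(1) D(4)] v(2) by simp
    then show "h X (FMor F g y) = FMor (proj_functor C Q) g (h Y y)"
      using h[OF X comp_closed[OF X Y D(2) g v(1)]] h[OF Y v(1)] v(2)
        comp_assoc[OF X Y D(2) Q(1) g v(1) Q(2)]
      by (simp add: proj_functor_def)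
  qed
  moreover have "bij_betw (h X) (carrier (FOb F X)) (carrier (FOb (proj_functor C Q) X))"
    if X: "X \<in> Obj C" for X
  proof (rule bij_betwI')
    fix x y assume "x \<in> carrier (FOb F X)" "y \<in> carrier (FOb F X)"
    then obtain u v where "u \<in> arr C X B" "x = FMor F u e" "v \<in> arr C X B" "y = FMor F v e"
      using D(6)[OF X] by metis
    then show "h X x = h X y \<longleftrightarrow> x = y" using h[OF X] eq_iff[OF X] by simp
  next
    fix x assume "x \<in> carrier (FOb F X)"
    then obtain u where "u \<in> arr C X B" "x = FMor F u e" using D(6)[OF X] by blast
    then show "h X x \<in> carrier (FOb (proj_functor C Q) X)"
      using car[OF X] h[OF X] by (simp add: proj_functor_def)
  next
    fix y assume "y \<in> carrier (FOb (proj_functor C Q) X)"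
    then obtain R a b where R: "projective C R" "R \<in> Obj C" and a: "a \<in> arr C X R" and b: "b \<in> arr C R Q"
      and y: "y = Comp C b a"
      by (auto simp: proj_functor_def proj_factoring_def projective_def)
    have "\<exists>b'\<in>arr C R B. Comp C q b' = b" using R(1) qe b D(2) Q(1) unfolding projective_def by blast
    then obtain b' where b': "b' \<in> arr C R B" "Comp C q b' = b" by blast
    have v: "Comp C b' a \<in> arr C X B" by (rule comp_closed[OF X R(2) D(2) a b'(1)])
    have "y = h X (FMor F (Comp C b' a) e)"
      using h[OF X v] comp_assoc[OF X R(2) D(2) Q(1) a b'(1) Q(2)] b'(2) y by simp
    then show "\<exists>x\<in>carrier (FOb F X). y = h X x"
      using functor_closed[OF Ff X D(2) v D(4)] by blast
  qed
  ultimately show ?thesis using Q(1) unfolding nat_iso_iff[OF Ff] by blast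
qed

end

theorem corollary4p5:
  fixes C :: "('o, 'm) ab_cat"
  assumes "abelian_category C"
    and "enough_projectives C"
  shows "(fp_shriek_star C :: ('o, 'm, 'v) ab_functor set) =
    {F \<in> fp C.
       (\<forall>G \<in> (fp0 C :: ('o, 'm, 'v) ab_functor set). trivial_group (nat_group C G F)) \<and>
       (\<forall>G \<in> (fp0 C :: ('o, 'm, 'v) ab_functor set). trivial_group (nat_group C F G))}"
proof -
  interpret abelian_category C by fact
  have Ff: "is_functor C F" if "F \<in> fp C" for F :: "('o, 'm, 'v) ab_functor"
    using that by (simp add: fp_def)
  show ?thesis (is "_ = ?R")
  proof (intro equalityI subsetI)
    fix F :: "('o, 'm, 'v) ab_functor" assume "F \<in> fp_shriek_star C"
    then obtain A where F: "F \<in> fp C" and A: "A \<in> Obj C" and iso: "nat_iso C F (proj_functor C A)"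
      unfolding fp_shriek_star_def by blast
    show "F \<in> ?R"
      by (intro CollectI conjI ballI F proj_functor_receives_zero[OF assms(2) Ff[OF F] A iso]
          proj_functor_emits_zero[OF Ff[OF F] A iso])
  next
    fix F :: "('o, 'm, 'v) ab_functor" assume F: "F \<in> ?R"
    have "\<exists>Q\<in>Obj C. nat_iso C F (proj_functor C Q)"
      by (rule orthogonal_imp_proj_functor[OF assms(2)]) (use F in simp_all)
    then show "F \<in> fp_shriek_star C" using F by (simp add: fp_shriek_star_def)
  qed
qed

end
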